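(* Let $\beta>1$ be a Parry number and let $n\ge 1$. If $X\subseteq\mathbb{R}^n$ is $\beta$-recognizable, then $X$ is $\beta$-definable.
   Context: Let $\beta>1$ be a real number. Expansions in dimension one. Let $A_\beta=\{0,1,\ldots,\lceil\beta\rceil-1\}$. For a real number $x\ge 0$, the $\beta$-expansion of $x$ is the infinite word $d_\beta(x)=x_k\cdots x_1x_0\star x_{-1}x_{-2}\cdots$ over $A_\beta\cup\{\star\}$, where $k\ge 0$ is minimal such that $x=\sum_{-\infty<i\le k}x_i\beta^i$ with $x_i\in A_\beta$ for all $i\le k$ and $\sum_{-\infty<i\le \ell}x_i\beta^i<\beta^{\ell+1}$ for all $\ell\le k$. For $x<0$, $d_\beta(x)$ is the word obtained from $d_\beta(-x)$ by replacing each digit $a$ by $-a$. Put $\tilde{A}_\beta=\{-(\lceil\beta\rceil-1),\ldots,0,\ldots,\lceil\beta\rceil-1\}$. Expansions in dimension $n$. Let $\mathbf{\tilde{A}}_\beta=(\tilde{A}_\beta)^n$, $\boldsymbol{\star}=(\star,\ldots,\star)$, $\mathbf{0}=(0,\ldots,0)$. For $\mathbf{x}=(x_1,\ldots,x_n)\in\mathbb{R}^n$, $d_\beta(\mathbf{x})$ is the word over $\mathbf{\tilde{A}}_\beta\cup\{\boldsymbol{\star}\}$ whose $i$th component belongs to $0^*d_\beta(x_i)$ for each $i$ (leading zeroes are added so that all the symbols $\star$ occur at the same position) and which does not start with $\mathbf{0}$, except if $|x_i|<1$ for all $i$, in which case the word starting with $\mathbf{0}\boldsymbol{\star}$ is chosen.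 For $X\subseteq\mathbb{R}^n$, $d_\beta(X)=\{d_\beta(\mathbf{x})\mid\mathbf{x}\in X\}$. Büchi automata. A Büchi automaton over a finite alphabet $A$ is a tuple $(Q,A,E,I,T)$ with $Q$ a finite set of states, $E\subseteq Q\times A\times Q$ the transitions, $I\subseteq Q$ the initial states and $T\subseteq Q$ the terminal states. It accepts an infinite word $u\in A^\omega$ if $u$ labels an infinite path starting in a state of $I$ and visiting $T$ infinitely often; its accepted language is the set of accepted infinite words. A set $X\subseteq\mathbb{R}^n$ is $\beta$-recognizable if some Büchi automaton over $\mathbf{\tilde{A}}_\beta\cup\{\boldsymbol{\star}\}$ accepts exactly the language $d_\beta(X)$. Definability. For $a\in\tilde{A}_\beta$, the binary predicate $X_{\beta,a}(x,y)$ on $\mathbb{R}^2$ holds if and only if $y$ is an integral power of $\beta$ and either $|x|<y$ and $a=0$, or $|x|\ge y$ and the digit of $d_\beta(x)=x_k\cdots x_0\star x_{-1}\cdots$ corresponding to $y$ is $a$ (that is, $y=\beta^i$ for some $i\le k$ and $x_i=a$). Let $X_\beta=\{X_{\beta,a}\mid a\in\tilde{A}_\beta\}$. A set $X\subseteq\mathbb{R}^n$ is $\beta$-definable if it is defined by a first order formula in the structure $\langle\mathbb{R},1,\le,+,X_\beta\rangle$. Parry numbers. The Rényi expansion of $1$, denoted $d_\beta^{*}(1)$, is the lexicographically greatest infinite word $w=w_1w_2\cdots\in A_\beta^\omega$ not ending in $0^\omega$ such that $\sum_{i\ge1}w_i\beta^{-i}=1$. The number $\beta$ is a Parry number if $d_\beta^{*}(1)$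 is ultimately periodic. *)

theory Defs
  imports
    "HOL-Analysis.Analysis"
    "HOL-Library.Omega_Words_Fun"
    "HOL-Library.Fun_Lexorder"
begin

section \<open>Expansions of real numbers\<close>

definition digits :: "real \<Rightarrow> int set" where
  "digits \<beta> = {0..\<lceil>\<beta>\<rceil> - 1}"

definition signed_digits :: "real \<Rightarrow> int set" where
  "signed_digits \<beta> = {- (\<lceil>\<beta>\<rceil> - 1)..\<lceil>\<beta>\<rceil> - 1}"

definition greedy_expansion :: "real \<Rightarrow> real \<Rightarrow> nat \<Rightarrow> (int \<Rightarrow> int) \<Rightarrow> bool" where
  "greedy_expansion \<beta> x k d \<longleftrightarrow>
     (\<forall>i\<le>int k. d i \<in> digits \<beta>) \<and>
     ((\<lambda>i. of_int (d i) * \<beta> powi i) has_sum x) {..int k} \<and>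
     (\<forall>l\<le>int k. (\<Sum>\<^sub>\<infinity>i\<in>{..l}. of_int (d i) * \<beta> powi i) < \<beta> powi (l + 1))"

definition top_index :: "real \<Rightarrow> real \<Rightarrow> nat" where
  "top_index \<beta> x = (LEAST k. \<exists>d. greedy_expansion \<beta> \<bar>x\<bar> k d)"

text \<open>Digits above the top index are not constrained by \<^const>\<open>greedy_expansion\<close>; they are
  set to 0 in order to make the digit function unique.\<close>

definition abs_digit :: "real \<Rightarrow> real \<Rightarrow> int \<Rightarrow> int" where
  "abs_digit \<beta> x =
     (THE d. greedy_expansion \<beta> \<bar>x\<bar> (top_index \<beta> x) d \<and> (\<forall>i>int (top_index \<beta> x). d i = 0))"

definition beta_digit :: "real \<Rightarrow> real \<Rightarrow> int \<Rightarrow> int" where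
  "beta_digit \<beta> x i = (if x < 0 then - abs_digit \<beta> x i else abs_digit \<beta> x i)"

datatype letter = Digit int | Star

text \<open>The word \<open>x\<^sub>k \<cdots> x\<^sub>0 \<star> x\<^sub>-\<^sub>1 x\<^sub>-\<^sub>2 \<cdots>\<close> with \<open>k = top_index \<beta> x\<close>.\<close>

definition beta_word :: "real \<Rightarrow> real \<Rightarrow> letter word" where
  "beta_word \<beta> x =
     map (\<lambda>i. Digit (beta_digit \<beta> x (int i))) (rev [0..<Suc (top_index \<beta> x)])
     \<frown> (Star ## (\<lambda>j. Digit (beta_digit \<beta> x (- int (Suc j)))))"


section \<open>Expansions of vectors\<close>

definition zero_vec :: "letter ^ 'n" where
  "zero_vec = (\<chi> i. Digit 0)"

definition star_vec :: "letter ^ 'n" where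
  "star_vec = (\<chi> i. Star)"

definition digit_vecs :: "real \<Rightarrow> (letter ^ 'n) set" where
  "digit_vecs \<beta> = {v. \<forall>i. v $ i \<in> Digit ` signed_digits \<beta>}"

definition alphabet :: "real \<Rightarrow> (letter ^ 'n) set" where
  "alphabet \<beta> = digit_vecs \<beta> \<union> {star_vec}"

text \<open>Membership of all letters in \<^const>\<open>alphabet\<close> forces the stars of the components to be
  aligned.\<close>

definition beta_word_vec :: "real \<Rightarrow> real ^ 'n \<Rightarrow> (letter ^ 'n) word" where
  "beta_word_vec \<beta> x = (THE w.
     (\<forall>j. w j \<in> alphabet \<beta>) \<and>
     (\<forall>i. \<exists>m. (\<lambda>j. w j $ i) = replicate m (Digit 0) \<frown> beta_word \<beta> (x $ i)) \<and>
     (if \<forall>i. \<bar>x $ i\<bar> < 1 then w 0 = zero_vec \<and> w 1 = star_vec else w 0 \<noteq> zero_vec))"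


section \<open>Buechi automata and recognizability\<close>

text \<open>The states are taken to be natural numbers: every finite set of states can be renamed
  in this way.\<close>

record 'a buchi =
  states :: "nat set"
  transitions :: "(nat \<times> 'a \<times> nat) set"
  initial :: "nat set"
  terminal :: "nat set"

definition buchi_automaton :: "'a set \<Rightarrow> 'a buchi \<Rightarrow> bool" where
  "buchi_automaton A M \<longleftrightarrow>
     finite A \<and> finite (states M) \<and>
     transitions M \<subseteq> states M \<times> A \<times> states M \<and>
     initial M \<subseteq> states M \<and> terminal M \<subseteq> states M"

definition buchi_accepts :: "'a buchi \<Rightarrow> 'a word \<Rightarrow> bool" where
  "buchi_accepts M u \<longleftrightarrow>
     (\<exists>r :: nat word. r 0 \<in> initial M \<and> (\<forall>j. (r j, u j, r (Suc j)) \<in> transitions M) \<and>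
        (\<exists>\<^sub>\<infinity>j. r j \<in> terminal M))"

definition buchi_language :: "'a buchi \<Rightarrow> 'a word set" where
  "buchi_language M = {u. buchi_accepts M u}"

definition beta_recognizable :: "real \<Rightarrow> (real ^ 'n) set \<Rightarrow> bool" where
  "beta_recognizable \<beta> X \<longleftrightarrow>
     (\<exists>M. buchi_automaton (alphabet \<beta>) M \<and> buchi_language M = beta_word_vec \<beta> ` X)"


section \<open>First-order definability\<close>

definition digit_pred :: "real \<Rightarrow> int \<Rightarrow> real \<Rightarrow> real \<Rightarrow> bool" where
  "digit_pred \<beta> a x y \<longleftrightarrow>
     (\<exists>i::int. y = \<beta> powi i \<and>
        (\<bar>x\<bar> < y \<and> a = 0 \<or> \<bar>x\<bar> \<ge> y \<and> i \<le> int (top_index \<beta> x) \<and> beta_digit \<beta> x i = a))"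

datatype 'v tm = Var 'v | One | Plus "'v tm" "'v tm"

datatype 'v fm =
    Eq "'v tm" "'v tm"
  | Le "'v tm" "'v tm"
  | DigitAt int "'v tm" "'v tm"
  | Neg "'v fm"
  | Conj "'v fm" "'v fm"
  | Disj "'v fm" "'v fm"
  | Ex 'v "'v fm"
  | All 'v "'v fm"

primrec tm_vars :: "'v tm \<Rightarrow> 'v set" where
  "tm_vars (Var v) = {v}"
| "tm_vars One = {}"
| "tm_vars (Plus s t) = tm_vars s \<union> tm_vars t"

primrec free_vars :: "'v fm \<Rightarrow> 'v set" where
  "free_vars (Eq s t) = tm_vars s \<union> tm_vars t"
| "free_vars (Le s t) = tm_vars s \<union> tm_vars t"
| "free_vars (DigitAt a s t) = tm_vars s \<union> tm_vars t"
| "free_vars (Neg p) = free_vars p"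
| "free_vars (Conj p q) = free_vars p \<union> free_vars q"
| "free_vars (Disj p q) = free_vars p \<union> free_vars q"
| "free_vars (Ex v p) = free_vars p - {v}"
| "free_vars (All v p) = free_vars p - {v}"

text \<open>The indices \<open>a\<close> of the predicate symbols \<open>X\<^sub>\<beta>\<^sub>,\<^sub>a\<close> occurring in a formula.\<close>

primrec digit_symbols :: "'v fm \<Rightarrow> int set" where
  "digit_symbols (Eq s t) = {}"
| "digit_symbols (Le s t) = {}"
| "digit_symbols (DigitAt a s t) = {a}"
| "digit_symbols (Neg p) = digit_symbols p"
| "digit_symbols (Conj p q) = digit_symbols p \<union> digit_symbols q"
| "digit_symbols (Disj p q) = digit_symbols p \<union> digit_symbols q"
| "digit_symbols (Ex v p) = digit_symbols p"
| "digit_symbols (All v p) = digit_symbols p"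

primrec tm_val :: "('v \<Rightarrow> real) \<Rightarrow> 'v tm \<Rightarrow> real" where
  "tm_val e (Var v) = e v"
| "tm_val e One = 1"
| "tm_val e (Plus s t) = tm_val e s + tm_val e t"

primrec holds :: "real \<Rightarrow> ('v \<Rightarrow> real) \<Rightarrow> 'v fm \<Rightarrow> bool" where
  "holds \<beta> e (Eq s t) \<longleftrightarrow> tm_val e s = tm_val e t"
| "holds \<beta> e (Le s t) \<longleftrightarrow> tm_val e s \<le> tm_val e t"
| "holds \<beta> e (DigitAt a s t) \<longleftrightarrow> digit_pred \<beta> a (tm_val e s) (tm_val e t)"
| "holds \<beta> e (Neg p) \<longleftrightarrow> \<not> holds \<beta> e p"
| "holds \<beta> e (Conj p q) \<longleftrightarrow> holds \<beta> e p \<and> holds \<beta> e q"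
| "holds \<beta> e (Disj p q) \<longleftrightarrow> holds \<beta> e p \<or> holds \<beta> e q"
| "holds \<beta> e (Ex v p) \<longleftrightarrow> (\<exists>r. holds \<beta> (e(v := r)) p)"
| "holds \<beta> e (All v p) \<longleftrightarrow> (\<forall>r. holds \<beta> (e(v := r)) p)"

text \<open>The variable \<open>Inl i\<close> stands for the \<open>i\<close>th coordinate of the vector; the variables \<open>Inr k\<close>
  supply infinitely many further names for bound variables, and their initial value is
  irrelevant since they do not occur free.\<close>

definition beta_definable :: "real \<Rightarrow> (real ^ 'n) set \<Rightarrow> bool" where
  "beta_definable \<beta> X \<longleftrightarrow>
     (\<exists>p :: ('n + nat) fm.
        free_vars p \<subseteq> range Inl \<and> digit_symbols p \<subseteq> signed_digits \<beta> \<and>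
        X = {x. holds \<beta> (case_sum (\<lambda>i. x $ i) (\<lambda>_. 0)) p})"


section \<open>Parry numbers\<close>

text \<open>Words are indexed from 0 here, so that \<open>w j\<close> is the digit of weight \<open>\<beta>\<close> to the power
  \<open>- (j + 1)\<close>.\<close>

definition one_expansions :: "real \<Rightarrow> int word set" where
  "one_expansions \<beta> =
     {w. range w \<subseteq> digits \<beta> \<and> (\<nexists>u. w = u \<frown> [0]\<^sup>\<omega>) \<and>
         (\<lambda>j. of_int (w j) * \<beta> powi (- int (Suc j))) sums 1}"

definition renyi_expansion :: "real \<Rightarrow> int word" where
  "renyi_expansion \<beta> =
     (THE w. w \<in> one_expansions \<beta> \<and> (\<forall>w'\<in>one_expansions \<beta>. w' = w \<or> less_fun w' w))"

definition ultimately_periodic :: "'a word \<Rightarrow> bool" where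
  "ultimately_periodic w \<longleftrightarrow> (\<exists>u v. v \<noteq> [] \<and> w = u \<frown> v\<^sup>\<omega>)"

definition parry_number :: "real \<Rightarrow> bool" where
  "parry_number \<beta> \<longleftrightarrow> \<beta> > 1 \<and> ultimately_periodic (renyi_expansion \<beta>)"

end

theory Submission
  imports Defs
begin

text \<open>
  A run of a Buechi automaton on the expansion of \<open>x\<close> assigns a state to every digit position. A
  first-order formula over the reals can express the existence of an accepting run as soon as it
  can quantify over such assignments, for everything else is local: the digits of \<open>x\<close> at a
  position are read by the predicates \<open>X\<^sub>\<beta>\<^sub>,\<^sub>a\<close>, and the position following \<open>y = \<beta>\<^sup>i\<close> is the
  greatest power of \<open>\<beta>\<close> below \<open>y\<close>, which the order defines.

  An assignment of states is coded by finitely many reals. An arbitrary set of positions need not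
  be the set of ones of a greedy expansion, but it is if its elements are at least \<open>N\<close> apart, where
  \<open>N\<close> is so large that \<open>1 + \<beta>\<^bsup>-N\<^esup> + \<beta>\<^bsup>-2N\<^esup> + \<dots> < \<beta>\<close>; this is lemma \<open>sparse_digits\<close>. Hence for every
  state \<open>q\<close> and every residue \<open>c\<close> modulo \<open>N\<close> there is a real \<open>z\<^sub>q\<^sub>,\<^sub>c\<close> whose ones are the positions
  congruent to \<open>c\<close> at which the run is in state \<open>q\<close>. Conversely, the run is read off from these
  reals without any mention of residues: the state is \<open>q\<close> where some \<open>z\<^sub>q\<^sub>,\<^sub>c\<close> has the digit 1 and
  no \<open>z\<close> belonging to another state does. Lemma \<open>accepting_run_iff\<close> states that acceptance is
  equivalent to the existence of such reals, and lemma \<open>env_definable_accepting_run\<close> that the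
  condition on them is definable. Since a vector is determined by its word
  (\<open>beta_word_vec_inject\<close>), acceptance of the word of \<open>x\<close> is the same as \<open>x \<in> X\<close>.
\<close>

section \<open>Greedy expansions through their remainders\<close>

text \<open>The value \<open>s l\<close> is the part of \<open>x\<close> contributed by the positions up to \<open>l\<close>. Recording these
  remainders replaces the infinite sums in \<^const>\<open>greedy_expansion\<close> by a recursion, and makes the
  notion independent of the index at which the expansion starts.\<close>

definition greedy_remainders :: "real \<Rightarrow> real \<Rightarrow> (int \<Rightarrow> int) \<Rightarrow> (int \<Rightarrow> real) \<Rightarrow> bool" where
  "greedy_remainders \<beta> x d s \<longleftrightarrow>
     (\<forall>l. s l = of_int (d l) * \<beta> powi l + s (l - 1)) \<and>
     (\<forall>l. 0 \<le> s l \<and> s l < \<beta> powi (l + 1)) \<and>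
     (\<exists>K. \<forall>l\<ge>K. s l = x)"

context
  fixes \<beta> :: real
  assumes beta_gt_1: "1 < \<beta>"
begin

lemma powi_pos: "0 < \<beta> powi l"
  using beta_gt_1 by simp

lemma powi_less_iff: "\<beta> powi i < \<beta> powi j \<longleftrightarrow> i < j"
  using beta_gt_1 by (metis linorder_neqE order_less_asym power_int_strict_increasing)

lemma powi_le_iff: "\<beta> powi i \<le> \<beta> powi j \<longleftrightarrow> i \<le> j"
  using powi_less_iff[of j i] by linarith

lemma powi_eq_iff: "\<beta> powi i = \<beta> powi j \<longleftrightarrow> i = j"
  using powi_less_iff[of j i] powi_less_iff[of i j] by linarith

lemma powi_eq_1_iff: "\<beta> powi i = 1 \<longleftrightarrow> i = 0"
  using powi_eq_iff[of i 0] by simp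

lemma powi_Suc: "\<beta> powi (l + 1) = \<beta> * \<beta> powi l"
  using beta_gt_1 by (simp add: power_int_add_1 mult.commute)

text \<open>The greedy algorithm: start at some \<open>K\<close> with \<open>x < \<beta>\<^sup>K\<close> and repeatedly take out the largest
  multiple of the current power of \<open>\<beta>\<close>.\<close>

lemma greedy_remainders_exist:
  assumes "0 \<le> x"
  shows "\<exists>d s. greedy_remainders \<beta> x d s"
proof -
  obtain n where n: "x < \<beta> ^ n"
    using real_arch_pow[OF beta_gt_1] by blast
  define K where "K = int n"
  have K: "x < \<beta> powi K" using n by (simp add: K_def power_int_of_nat)
  define R where "R = rec_nat x (\<lambda>m r. r - of_int \<lfloor>r / \<beta> powi (K - 1 - int m)\<rfloor> * \<beta> powi (K - 1 - int m))"
  have R0: "R 0 = x" by (simp add: R_def)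
  have RS: "R (Suc m) = R m - of_int \<lfloor>R m / \<beta> powi (K - 1 - int m)\<rfloor> * \<beta> powi (K - 1 - int m)" for m
    by (simp add: R_def)
  have R: "0 \<le> R m \<and> R m < \<beta> powi (K - int m)" for m
  proof (cases m)
    case 0
    then show ?thesis using assms K R0 by simp
  next
    case (Suc j)
    let ?p = "\<beta> powi (K - 1 - int j)"
    have p: "0 < ?p" by (rule powi_pos)
    have "of_int \<lfloor>R j / ?p\<rfloor> \<le> R j / ?p" "R j / ?p < of_int \<lfloor>R j / ?p\<rfloor> + 1" by linarith+
    then have "of_int \<lfloor>R j / ?p\<rfloor> * ?p \<le> R j" "R j < (of_int \<lfloor>R j / ?p\<rfloor> + 1) * ?p"
      using pos_le_divide_eq[OF p] pos_divide_less_eq[OF p] by blast+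
    moreover have "K - int m = K - 1 - int j" using Suc by simp
    ultimately show ?thesis using RS[of j] Suc by (simp add: algebra_simps)
  qed
  (* nat truncates, so that s is constantly x from K - 1 upwards *)
  define s where "s l = R (nat (K - 1 - l))" for l
  define d where "d l = \<lfloor>s l / \<beta> powi l\<rfloor>" for l
  have "s l = of_int (d l) * \<beta> powi l + s (l - 1)" for l
  proof (cases "l \<ge> K")
    case True
    then have "x < \<beta> powi l" using K powi_le_iff[of K l] by linarith
    then have "\<lfloor>x / \<beta> powi l\<rfloor> = 0" using assms powi_pos[of l] by (simp add: floor_eq_iff)
    then show ?thesis using True R0 by (simp add: s_def d_def)
  next
    case False
    define m where "m = nat (K - 1 - l)"
    have "s l = R m" "s (l - 1) = R (Suc m)" "l = K - 1 - int m"
      using False by (auto simp: s_def m_def nat_diff_distrib' Suc_nat_eq_nat_zadd1 intro!: arg_cong[of _ _ R])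
    then show ?thesis using RS[of m] by (simp add: d_def)
  qed
  moreover have "0 \<le> s l \<and> s l < \<beta> powi (l + 1)" for l
  proof (cases "l \<ge> K")
    case True
    then have "\<beta> powi K \<le> \<beta> powi (l + 1)" by (simp add: powi_le_iff)
    then show ?thesis using True R0 K assms by (simp add: s_def)
  next
    case False
    then show ?thesis using R[of "nat (K - 1 - l)"] by (simp add: s_def add.commute)
  qed
  moreover have "\<forall>l\<ge>K. s l = x" by (simp add: s_def R0)
  ultimately show ?thesis unfolding greedy_remainders_def by blast
qed

lemma greedy_remaindersD:
  assumes "greedy_remainders \<beta> x d s"
  shows "s l = of_int (d l) * \<beta> powi l + s (l - 1)" "0 \<le> s l" "s l < \<beta> powi (l + 1)"
  using assms unfolding greedy_remainders_def by blast+

lemma greedy_remainders_digit: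
  assumes "greedy_remainders \<beta> x d s"
  shows "d l = \<lfloor>s l / \<beta> powi l\<rfloor>"
proof -
  have s: "s l = of_int (d l) * \<beta> powi l + s (l - 1)" "0 \<le> s (l - 1)" "s (l - 1) < \<beta> powi l"
    using greedy_remaindersD[OF assms, of l] greedy_remaindersD[OF assms, of "l - 1"] by simp_all
  have "s l / \<beta> powi l = of_int (d l) + s (l - 1) / \<beta> powi l"
    using powi_pos[of l] beta_gt_1 by (subst s(1)) (simp add: add_divide_distrib)
  moreover have "0 \<le> s (l - 1) / \<beta> powi l" "s (l - 1) / \<beta> powi l < 1"
    using s powi_pos[of l] by simp_all
  ultimately show ?thesis by linarith
qed

text \<open>Both remainders agree with \<open>x\<close> far up; each digit, and with it the next remainder, is computed
  from the remainder above it.\<close>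

lemma greedy_remainders_unique:
  assumes "greedy_remainders \<beta> x d s" "greedy_remainders \<beta> x d' s'"
  shows "d = d'" "s = s'"
proof -
  obtain K K' where K: "\<forall>l\<ge>K. s l = x" "\<forall>l\<ge>K'. s' l = x"
    using assms unfolding greedy_remainders_def by blast
  have "s l = s' l" if "l \<le> max K K'" for l
    using that
  proof (induction l rule: int_le_induct)
    case base
    then show ?case using K by simp
  next
    case (step i)
    then have "d i = d' i" using assms greedy_remainders_digit by metis
    moreover have "s i = of_int (d i) * \<beta> powi i + s (i - 1)" "s' i = of_int (d' i) * \<beta> powi i + s' (i - 1)"
      using assms unfolding greedy_remainders_def by blast+
    ultimately show ?case using step by simp
  qed
  moreover have "s l = s' l" if "l \<ge> max K K'" for l using K that by simp
  ultimately show s: "s = s'" by (metis ext linear)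
  show "d = d'" using s greedy_remainders_digit[OF assms(1)] greedy_remainders_digit[OF assms(2)] by auto
qed

lemma greedy_remainders_digit_nonneg:
  assumes "greedy_remainders \<beta> x d s"
  shows "0 \<le> d l"
  using greedy_remaindersD(2)[OF assms, of l] greedy_remainders_digit[OF assms, of l] powi_pos[of l]
  by simp

lemma greedy_remainders_in_digits:
  assumes "greedy_remainders \<beta> x d s"
  shows "d l \<in> digits \<beta>"
proof -
  have "s l < \<beta> * \<beta> powi l" using greedy_remaindersD(3)[OF assms, of l] by (simp add: powi_Suc)
  then have "s l / \<beta> powi l < \<beta>" using powi_pos[of l] by (simp add: pos_divide_less_eq)
  then have "of_int (d l) < \<beta>" using greedy_remainders_digit[OF assms, of l] by linarith
  then have "d l \<le> \<lceil>\<beta>\<rceil> - 1" by linarith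
  then show ?thesis using greedy_remainders_digit_nonneg[OF assms] by (simp add: digits_def)
qed

lemma greedy_remainders_mono:
  assumes "greedy_remainders \<beta> x d s" "l \<le> m"
  shows "s l \<le> s m"
  using assms(2)
proof (induction l rule: int_le_induct)
  case (step i)
  have "s i = of_int (d i) * \<beta> powi i + s (i - 1)"
    using assms(1) unfolding greedy_remainders_def by blast
  then have "s (i - 1) \<le> s i"
    using greedy_remainders_digit_nonneg[OF assms(1), of i] powi_pos[of i] by simp
  then show ?case using step by simp
qed simp

lemma greedy_remainders_le:
  assumes "greedy_remainders \<beta> x d s"
  shows "s l \<le> x"
proof -
  obtain K where K: "\<forall>l\<ge>K. s l = x"
    using assms unfolding greedy_remainders_def by blast
  then show ?thesis using greedy_remainders_mono[OF assms, of l "max l K"] by simp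
qed

lemma greedy_remainders_digit_eq_0:
  assumes "greedy_remainders \<beta> x d s" "x < \<beta> powi l"
  shows "d l = 0"
  using greedy_remainders_digit[OF assms(1), of l] greedy_remainders_le[OF assms(1), of l] assms(2)
    greedy_remaindersD(2)[OF assms(1), of l] powi_pos[of l]
  by (auto simp: floor_eq_iff)

lemma greedy_remainders_eq:
  assumes "greedy_remainders \<beta> x d s" "x < \<beta> powi (l + 1)"
  shows "s l = x"
proof -
  obtain K where K: "\<forall>l\<ge>K. s l = x"
    using assms unfolding greedy_remainders_def by blast
  have "s m = x" if "l \<le> m" "m \<le> max l K" for m
    using that(2,1)
  proof (induction m rule: int_le_induct)
    case base
    then show ?case using K by simp
  next
    case (step i)
    have "\<beta> powi (l + 1) \<le> \<beta> powi i" using step by (simp add: powi_le_iff)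
    then have "d i = 0" using greedy_remainders_digit_eq_0[OF assms(1)] assms(2) by simp
    moreover have "s i = of_int (d i) * \<beta> powi i + s (i - 1)"
      using assms(1) unfolding greedy_remainders_def by blast
    ultimately show ?case using step by simp
  qed
  then show ?thesis by simp
qed

text \<open>The partial sums telescope to \<open>s l - s (l - m)\<close>, and the subtracted remainder is less than
  \<open>\<beta>\<close> to the power \<open>l + 1 - m\<close>.\<close>

lemma greedy_remainders_has_sum:
  assumes "greedy_remainders \<beta> x d s"
  shows "((\<lambda>i. of_int (d i) * \<beta> powi i) has_sum s l) {..l}"
proof -
  let ?f = "\<lambda>i. of_int (d i) * \<beta> powi i"
  have rec: "s i = ?f i + s (i - 1)" for i
    using assms unfolding greedy_remainders_def by blast
  have part: "(\<Sum>n<m. ?f (l - int n)) = s l - s (l - int m)" for m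
  proof (induction m)
    case (Suc m)
    have "s (l - int m) = ?f (l - int m) + s (l - int (Suc m))"
      using rec[of "l - int m"] by (simp add: algebra_simps)
    then show ?case using Suc by simp
  qed simp
  have "(\<lambda>m. s (l - int m)) \<longlonglongrightarrow> 0"
  proof (rule tendsto_sandwich)
    show "\<forall>\<^sub>F m in sequentially. 0 \<le> s (l - int m)"
      using greedy_remaindersD(2)[OF assms] by simp
    have "s (l - int m) \<le> \<beta> powi (l + 1) * inverse \<beta> ^ m" for m
    proof -
      have "\<beta> powi (l + 1 - int m) = \<beta> powi (l + 1) * inverse \<beta> ^ m"
        using beta_gt_1 by (simp add: power_int_diff power_int_of_nat divide_inverse power_inverse)
      moreover have "s (l - int m) < \<beta> powi (l - int m + 1)"
        using assms unfolding greedy_remainders_def by blast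
      ultimately show ?thesis by (simp add: algebra_simps)
    qed
    then show "\<forall>\<^sub>F m in sequentially. s (l - int m) \<le> \<beta> powi (l + 1) * inverse \<beta> ^ m" by simp
    have "(\<lambda>m. inverse \<beta> ^ m) \<longlonglongrightarrow> 0"
      using beta_gt_1 by (intro LIMSEQ_power_zero) (simp add: inverse_less_1_iff)
    then show "(\<lambda>m. \<beta> powi (l + 1) * inverse \<beta> ^ m) \<longlonglongrightarrow> 0"
      by (rule tendsto_mult_right_zero)
  qed simp
  then have "(\<lambda>m. s l - s (l - int m)) \<longlonglongrightarrow> s l - 0"
    by (intro tendsto_intros)
  then have sums: "(\<lambda>n. ?f (l - int n)) sums s l"
    by (simp add: sums_def part)
  have "((\<lambda>n. ?f (l - int n)) has_sum s l) UNIV"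
  proof (rule norm_summable_imp_has_sum[OF _ sums])
    have "0 \<le> ?f i" for i
      using greedy_remainders_digit_nonneg[OF assms] powi_pos[of i] by simp
    then show "summable (\<lambda>n. norm (?f (l - int n)))"
      using sums by (simp add: sums_iff)
  qed
  moreover have "bij_betw (\<lambda>n. l - int n) UNIV {..l}"
    by (rule bij_betw_byWitness[of _ "\<lambda>i. nat (l - i)"]) auto
  ultimately show ?thesis
    using has_sum_reindex_bij_betw[of "\<lambda>n. l - int n" UNIV "{..l}" ?f] by simp
qed

lemma greedy_remainders_imp_expansion:
  assumes "greedy_remainders \<beta> x d s" "x < \<beta> powi (int k + 1)"
  shows "greedy_expansion \<beta> x k d"
  unfolding greedy_expansion_def
proof (intro conjI allI impI)
  show "d i \<in> digits \<beta>" for i by (rule greedy_remainders_in_digits[OF assms(1)])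
  show "((\<lambda>i. of_int (d i) * \<beta> powi i) has_sum x) {..int k}"
    using greedy_remainders_has_sum[OF assms(1), of "int k"] greedy_remainders_eq[OF assms] by simp
  show "(\<Sum>\<^sub>\<infinity>i\<in>{..l}. of_int (d i) * \<beta> powi i) < \<beta> powi (l + 1)" for l
    using greedy_remainders_has_sum[OF assms(1), of l] greedy_remaindersD(3)[OF assms(1), of l]
    by (simp add: infsumI)
qed

lemma expansion_imp_less:
  assumes "greedy_expansion \<beta> x k d"
  shows "x < \<beta> powi (int k + 1)"
  using assms unfolding greedy_expansion_def by (metis infsumI order_refl)

text \<open>The remainders are the tails of the series. The digits above \<open>k\<close> have to vanish because
  \<^const>\<open>greedy_expansion\<close> leaves them open.\<close>

lemma expansion_imp_greedy_remainders:
  assumes g: "greedy_expansion \<beta> x k d" and z: "\<forall>i>int k. d i = 0"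
  shows "\<exists>s. greedy_remainders \<beta> x d s"
proof -
  let ?f = "\<lambda>i. of_int (d i) * \<beta> powi i"
  define s where "s l = infsum ?f {..l}" for l
  have nonneg: "0 \<le> ?f i" for i
    using g z powi_pos[of i] by (cases "i \<le> int k") (auto simp: greedy_expansion_def digits_def)
  have sum_x: "(?f has_sum x) {..int k}" using g by (simp add: greedy_expansion_def)
  have high: "(?f has_sum x) {..l}" if "l \<ge> int k" for l
    using sum_x by (rule has_sum_cong_neutral[THEN iffD1, rotated -1]) (use z that in auto)
  have summ: "?f summable_on {..l}" for l
  proof (rule summable_on_subset_banach)
    show "?f summable_on {..max l (int k)}" using high[of "max l (int k)"] by (auto simp: summable_on_def)
  qed auto
  have high': "s l = x" if "l \<ge> int k" for l
    using high[OF that] by (simp add: s_def infsumI)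
  have "s l = ?f l + s (l - 1)" for l
  proof -
    have "{..l} = insert l {..l - 1}" by auto
    then show ?thesis using infsum_insert[OF summ, of l "l - 1"] by (simp add: s_def)
  qed
  moreover have "0 \<le> s l" for l
    unfolding s_def by (rule infsum_nonneg) (rule nonneg)
  moreover have "s l < \<beta> powi (l + 1)" for l
  proof (cases "l \<le> int k")
    case True
    then show ?thesis using g by (simp add: greedy_expansion_def s_def)
  next
    case False
    then have "\<beta> powi (int k + 1) \<le> \<beta> powi (l + 1)" by (simp add: powi_le_iff)
    then show ?thesis using False high' expansion_imp_less[OF g] by simp
  qed
  ultimately show ?thesis unfolding greedy_remainders_def using high' by blast
qed

lemma expansion_exists_iff:
  assumes "0 \<le> x"
  shows "(\<exists>d. greedy_expansion \<beta> x k d) \<longleftrightarrow> x < \<beta> powi (int k + 1)"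
  using greedy_remainders_exist[OF assms] greedy_remainders_imp_expansion expansion_imp_less by blast

section \<open>Digits of a real number\<close>

lemma top_index_less: "\<bar>x\<bar> < \<beta> powi (int (top_index \<beta> x) + 1)"
proof -
  obtain n where "\<bar>x\<bar> < \<beta> ^ n" using real_arch_pow[OF beta_gt_1] by blast
  moreover have "\<beta> ^ n \<le> \<beta> powi (int n + 1)"
    using powi_le_iff[of "int n" "int n + 1"] by (simp add: power_int_of_nat)
  ultimately have "\<exists>d. greedy_expansion \<beta> \<bar>x\<bar> n d" using expansion_exists_iff by simp
  then have "\<exists>d. greedy_expansion \<beta> \<bar>x\<bar> (top_index \<beta> x) d" unfolding top_index_def by (rule LeastI)
  then show ?thesis using expansion_imp_less by blast
qed

lemma top_index_le:
  assumes "\<bar>x\<bar> < \<beta> powi (int k + 1)"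
  shows "top_index \<beta> x \<le> k"
  unfolding top_index_def by (rule Least_le) (use assms expansion_exists_iff in simp)

lemma abs_digit_remainders: "\<exists>s. greedy_remainders \<beta> \<bar>x\<bar> (abs_digit \<beta> x) s"
proof -
  obtain d s where ds: "greedy_remainders \<beta> \<bar>x\<bar> d s" using greedy_remainders_exist by fastforce
  have "\<forall>i>int (top_index \<beta> x). d i = 0"
  proof (intro allI impI)
    fix i assume "i > int (top_index \<beta> x)"
    then have "\<bar>x\<bar> < \<beta> powi i" using top_index_less[of x] powi_le_iff[of "int (top_index \<beta> x) + 1" i] by simp
    then show "d i = 0" by (rule greedy_remainders_digit_eq_0[OF ds])
  qed
  then have "abs_digit \<beta> x = d" unfolding abs_digit_def
    using greedy_remainders_imp_expansion[OF ds top_index_less]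
      expansion_imp_greedy_remainders greedy_remainders_unique(1)[OF _ ds]
    by (intro the_equality) blast+
  then show ?thesis using ds by blast
qed

lemma abs_digit_eqI: "greedy_remainders \<beta> \<bar>x\<bar> d s \<Longrightarrow> abs_digit \<beta> x = d"
  using abs_digit_remainders greedy_remainders_unique(1) by blast

lemma abs_digit_eq_0: "\<bar>x\<bar> < \<beta> powi i \<Longrightarrow> abs_digit \<beta> x i = 0"
  using abs_digit_remainders greedy_remainders_digit_eq_0 by blast

lemma beta_digit_eq_0: "\<bar>x\<bar> < \<beta> powi i \<Longrightarrow> beta_digit \<beta> x i = 0"
  by (simp add: beta_digit_def abs_digit_eq_0)

lemma beta_digit_above_top: "int (top_index \<beta> x) < i \<Longrightarrow> beta_digit \<beta> x i = 0"
  using top_index_less[of x] powi_le_iff[of "int (top_index \<beta> x) + 1" i] by (intro beta_digit_eq_0) simp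

lemma abs_digit_in_digits: "abs_digit \<beta> x i \<in> digits \<beta>"
  using abs_digit_remainders greedy_remainders_in_digits by blast

lemma abs_beta_digit: "\<bar>beta_digit \<beta> x i\<bar> = abs_digit \<beta> x i"
  using abs_digit_in_digits[of x i] by (auto simp: beta_digit_def digits_def)

lemma beta_digit_in_signed_digits: "beta_digit \<beta> x i \<in> signed_digits \<beta>"
  using abs_digit_in_digits[of x i] by (auto simp: beta_digit_def digits_def signed_digits_def)

lemma beta_digit_top:
  assumes "1 \<le> \<bar>x\<bar>"
  shows "beta_digit \<beta> x (int (top_index \<beta> x)) \<noteq> 0"
proof -
  let ?k = "int (top_index \<beta> x)"
  obtain s where s: "greedy_remainders \<beta> \<bar>x\<bar> (abs_digit \<beta> x) s" using abs_digit_remainders by blast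
  have "\<beta> powi ?k \<le> \<bar>x\<bar>"
  proof (cases "top_index \<beta> x")
    case (Suc j)
    have "\<not> \<bar>x\<bar> < \<beta> powi (int j + 1)" using top_index_le[of x j] Suc by auto
    then show ?thesis using Suc by (simp add: add.commute)
  qed (use assms in simp)
  then have "1 \<le> \<bar>x\<bar> / \<beta> powi ?k" using powi_pos[of ?k] by simp
  then have "1 \<le> abs_digit \<beta> x ?k"
    using greedy_remainders_digit[OF s, of ?k] greedy_remainders_eq[OF s top_index_less] by simp
  then show ?thesis using abs_beta_digit[of x ?k] by auto
qed

lemma top_index_eq_0_iff: "top_index \<beta> x = 0 \<longleftrightarrow> \<bar>x\<bar> < \<beta>"
  using top_index_less[of x] top_index_le[of x 0] by auto

text \<open>The digits determine \<open>\<bar>x\<bar>\<close> as a sum. If \<open>x\<close> and \<open>y\<close> had different signs, then every common digit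
  would be both nonnegative and nonpositive, hence zero.\<close>

lemma beta_digit_inject:
  assumes "\<And>i. beta_digit \<beta> x i = beta_digit \<beta> y i"
  shows "x = y"
proof -
  have abs: "abs_digit \<beta> x = abs_digit \<beta> y" using assms abs_beta_digit by (metis ext)
  obtain s t where s: "greedy_remainders \<beta> \<bar>x\<bar> (abs_digit \<beta> x) s"
    and t: "greedy_remainders \<beta> \<bar>y\<bar> (abs_digit \<beta> y) t"
    using abs_digit_remainders by blast
  obtain K K' where "\<forall>l\<ge>K. s l = \<bar>x\<bar>" "\<forall>l\<ge>K'. t l = \<bar>y\<bar>"
    using s t unfolding greedy_remainders_def by blast
  moreover have "s l = t l" for l
    using greedy_remainders_has_sum[OF s, of l] greedy_remainders_has_sum[OF t, of l] abs
    by (simp add: has_sum_unique)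
  ultimately have eq: "\<bar>x\<bar> = \<bar>y\<bar>" by (metis linear)
  show ?thesis
  proof (rule ccontr)
    assume "x \<noteq> y"
    then have sgn: "(x < 0) \<noteq> (y < 0)" using eq by auto
    have "abs_digit \<beta> x i = 0" for i
      using assms[of i] sgn abs by (auto simp: beta_digit_def split: if_splits)
    then have "s l = 0" for l
      using greedy_remainders_has_sum[OF s, of l] by (auto dest: infsumI)
    then have "\<bar>x\<bar> = 0" using s unfolding greedy_remainders_def by (metis order_refl)
    then show False using eq sgn by simp
  qed
qed

text \<open>The two cases of \<^const>\<open>digit_pred\<close> merge, since digits above the leading one are zero.\<close>

lemma digit_pred_iff:
  "digit_pred \<beta> a x y \<longleftrightarrow> (\<exists>i. y = \<beta> powi i \<and> beta_digit \<beta> x i = a)"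
proof -
  have "i \<le> int (top_index \<beta> x)" if "\<beta> powi i \<le> \<bar>x\<bar>" for i
    using that top_index_less[of x] powi_less_iff[of i "int (top_index \<beta> x) + 1"] by simp
  then show ?thesis unfolding digit_pred_def by (metis beta_digit_eq_0 not_less)
qed

section \<open>Sparse sets of positions are expansions\<close>

text \<open>The bound is the value for the densest set, \<open>l, l - N, l - 2N, \<dots>\<close>, a geometric series; the induction removes the largest element.\<close>

lemma sparse_sum_le:
  assumes "finite F" and "0 < N" and "\<And>i j. i \<in> F \<Longrightarrow> j \<in> F \<Longrightarrow> i < j \<Longrightarrow> i + int N \<le> j"
    and "\<And>i. i \<in> F \<Longrightarrow> i \<le> l"
  shows "(\<Sum>i\<in>F. \<beta> powi i) \<le> \<beta> powi l / (1 - \<beta> powi (- int N))"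
  using assms
proof (induction "card F" arbitrary: F l)
  case 0
  have "\<beta> powi (- int N) < 1" using \<open>0 < N\<close> powi_less_iff[of "- int N" 0] by simp
  then show ?case using 0 powi_pos[of l] by simp
next
  case (Suc n)
  let ?q = "\<beta> powi (- int N)"
  have q: "?q < 1" using \<open>0 < N\<close> powi_less_iff[of "- int N" 0] by simp
  define m where "m = Max F"
  have "m \<in> F" using Suc.hyps(2) Suc.prems(1) unfolding m_def by (intro Max_in) auto
  then have m: "m \<in> F" "m \<le> l" using Suc.prems(4) by auto
  have le: "i \<le> m - int N" if "i \<in> F - {m}" for i
  proof -
    have "i < m" using that Suc.prems(1) Max_ge[of F i] by (auto simp: m_def order_less_le)
    then show ?thesis using that Suc.prems(3)[of i m] m by simp
  qed
  have "(\<Sum>i\<in>F - {m}. \<beta> powi i) \<le> \<beta> powi (m - int N) / (1 - ?q)"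
    by (rule Suc.hyps(1)) (use Suc.hyps(2) Suc.prems m le in auto)
  also have "\<beta> powi (m - int N) = \<beta> powi m * ?q"
    using beta_gt_1 by (simp add: power_int_diff power_int_minus field_simps)
  finally have "(\<Sum>i\<in>F. \<beta> powi i) \<le> \<beta> powi m + \<beta> powi m * ?q / (1 - ?q)"
    using m Suc.prems(1) by (simp add: sum.remove)
  also have "\<dots> = \<beta> powi m / (1 - ?q)" using q by (simp add: field_simps)
  also have "\<dots> \<le> \<beta> powi l / (1 - ?q)"
    using m q by (intro divide_right_mono) (auto simp: powi_le_iff)
  finally show ?case .
qed

text \<open>The left-hand side is the sum of the geometric series, which tends to 1 as \<open>N\<close> grows.\<close>

lemma sparse_gap: "\<exists>N>0. 1 / (1 - \<beta> powi (- int N)) < \<beta>"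
proof -
  have "0 < 1 - 1 / \<beta>" using beta_gt_1 by simp
  then obtain N where N: "(1 / \<beta>) ^ N < 1 - 1 / \<beta>"
    using real_arch_pow_inv[of "1 - 1 / \<beta>" "1 / \<beta>"] beta_gt_1 by auto
  have "N \<noteq> 0" using N beta_gt_1 by (intro notI) simp
  have "\<beta> powi (- int N) = (1 / \<beta>) ^ N"
    by (simp add: power_int_minus power_int_of_nat power_one_over inverse_eq_divide)
  then have inv_less: "1 / \<beta> < 1 - \<beta> powi (- int N)" using N by simp
  have "0 < 1 / \<beta>" using beta_gt_1 by simp
  from this inv_less have "0 < 1 - \<beta> powi (- int N)" by (rule order_less_trans)
  moreover have "1 < \<beta> * (1 - \<beta> powi (- int N))"
    using beta_gt_1 pos_divide_less_eq[of \<beta> 1 "1 - \<beta> powi (- int N)"] inv_less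
    by (simp add: mult.commute)
  ultimately have "1 / (1 - \<beta> powi (- int N)) < \<beta>"
    by (simp add: pos_divide_less_eq)
  then show ?thesis using \<open>N \<noteq> 0\<close> by blast
qed

text \<open>By \<open>sparse_sum_le\<close> and the choice of \<open>N\<close>, every tail of the series of powers indexed by \<open>S\<close> stays
  below the next power of \<open>\<beta>\<close>, which is the greedy condition for the indicator sequence of \<open>S\<close>.\<close>

lemma sparse_digits:
  assumes "0 < N" and gap: "1 / (1 - \<beta> powi (- int N)) < \<beta>"
    and sparse: "\<And>i j. i \<in> S \<Longrightarrow> j \<in> S \<Longrightarrow> i < j \<Longrightarrow> i + int N \<le> j"
    and bound: "\<And>i. i \<in> S \<Longrightarrow> i \<le> int k"
  shows "\<exists>z. \<forall>i. beta_digit \<beta> z i = (if i \<in> S then 1 else 0)"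
proof -
  define d :: "int \<Rightarrow> int" where "d i = (if i \<in> S then 1 else 0)" for i
  let ?f = "\<lambda>i. of_int (d i) * \<beta> powi i"
  define C where "C = 1 / (1 - \<beta> powi (- int N))"
  have nonneg: "0 \<le> ?f i" for i using powi_pos[of i] by (simp add: d_def)
  have fin: "sum ?f F \<le> C * \<beta> powi l" if F: "finite F" "F \<subseteq> {..l}" for F l
  proof -
    have "sum ?f F = (\<Sum>i\<in>F \<inter> S. \<beta> powi i)"
      using F(1) by (simp add: d_def sum.inter_restrict if_distrib[of "\<lambda>a. of_int a * _"] cong: if_cong)
    also have "\<dots> \<le> \<beta> powi l / (1 - \<beta> powi (- int N))"
      by (rule sparse_sum_le) (use F sparse assms(1) in auto)
    finally show ?thesis by (simp add: C_def)
  qed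
  have summ: "?f summable_on {..l}" for l
    by (rule nonneg_bdd_above_summable_on) (use nonneg fin in \<open>auto intro!: bdd_aboveI2\<close>)
  have "infsum ?f {..l} < \<beta> powi (l + 1)" for l
  proof -
    have "infsum ?f {..l} \<le> C * \<beta> powi l"
      by (rule infsum_le_finite_sums[OF summ]) (use fin in auto)
    also have "\<dots> < \<beta> powi (l + 1)" using mult_strict_right_mono[OF gap powi_pos[of l]] by (simp add: C_def powi_Suc)
    finally show ?thesis .
  qed
  moreover have "1 \<le> \<lceil>\<beta>\<rceil> - 1" using beta_gt_1 by linarith
  then have "d i \<in> digits \<beta>" for i by (simp add: d_def digits_def)
  ultimately have "greedy_expansion \<beta> (infsum ?f {..int k}) k d"
    unfolding greedy_expansion_def using summ[of "int k"] by auto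
  moreover have "\<forall>i>int k. d i = 0" using bound by (fastforce simp: d_def)
  ultimately obtain s where s: "greedy_remainders \<beta> (infsum ?f {..int k}) d s"
    using expansion_imp_greedy_remainders by blast
  moreover have "0 \<le> infsum ?f {..int k}" by (rule infsum_nonneg) (rule nonneg)
  ultimately have "beta_digit \<beta> (infsum ?f {..int k}) = d"
    using abs_digit_eqI[of "infsum ?f {..int k}" d s] by (auto simp: beta_digit_def fun_eq_iff)
  then have "\<forall>i. beta_digit \<beta> (infsum ?f {..int k}) i = (if i \<in> S then 1 else 0)"
    by (simp add: d_def)
  then show ?thesis ..
qed

end

section \<open>Words of vectors\<close>

text \<open>The word \<open>a\<^sub>k \<cdots> a\<^sub>0 s a\<^sub>-\<^sub>1 a\<^sub>-\<^sub>2 \<cdots>\<close>.\<close>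

definition aligned_word :: "nat \<Rightarrow> (int \<Rightarrow> 'a) \<Rightarrow> 'a \<Rightarrow> 'a word" where
  "aligned_word k a s j =
     (if j \<le> k then a (int k - int j) else if j = Suc k then s else a (int k + 1 - int j))"

definition digit_vec :: "real \<Rightarrow> real ^ 'n \<Rightarrow> int \<Rightarrow> letter ^ 'n" where
  "digit_vec \<beta> x i = (\<chi> c. Digit (beta_digit \<beta> (x $ c) i))"

definition top_index_vec :: "real \<Rightarrow> real ^ 'n \<Rightarrow> nat" where
  "top_index_vec \<beta> x = Max (range (\<lambda>c. top_index \<beta> (x $ c)))"

lemma aligned_word_star: "aligned_word k a s (Suc k) = s"
  by (simp add: aligned_word_def)

lemma aligned_word_eq_star_iff:
  assumes "\<And>i. a i \<noteq> s"
  shows "aligned_word k a s j = s \<longleftrightarrow> j = Suc k"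
  using assms by (auto simp: aligned_word_def)

lemma aligned_word_at:
  assumes "i \<le> int k"
  shows "aligned_word k a s (if 0 \<le> i then nat (int k - i) else nat (int k + 1 - i)) = a i"
  using assms by (auto simp: aligned_word_def intro!: arg_cong[of _ _ a])

lemma top_index_le_vec: "top_index \<beta> (x $ c) \<le> top_index_vec \<beta> x"
  by (simp add: top_index_vec_def)

lemma digit_vec_in_alphabet:
  assumes "1 < \<beta>"
  shows "digit_vec \<beta> x i \<in> digit_vecs \<beta>"
  using beta_digit_in_signed_digits[OF assms] by (simp add: digit_vec_def digit_vecs_def)

lemma digit_vec_eq_zero_iff: "digit_vec \<beta> x i = zero_vec \<longleftrightarrow> (\<forall>c. beta_digit \<beta> (x $ c) i = 0)"
  by (simp add: digit_vec_def zero_vec_def vec_eq_iff)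

lemma digit_vec_neq_star: "digit_vec \<beta> x i \<noteq> star_vec"
  by (simp add: digit_vec_def star_vec_def vec_eq_iff)

text \<open>Padding with zeros is the same as starting to read above the leading digit, as the digits there
  are zero.\<close>

lemma padded_beta_word:
  assumes "1 < \<beta>"
  shows "replicate m (Digit 0) \<frown> beta_word \<beta> x =
    aligned_word (m + top_index \<beta> x) (\<lambda>i. Digit (beta_digit \<beta> x i)) Star"
proof
  fix j
  let ?k = "top_index \<beta> x"
  consider "j < m" | "m \<le> j" "j \<le> m + ?k" | "j = Suc (m + ?k)" | "Suc (m + ?k) < j" by linarith
  then show "(replicate m (Digit 0) \<frown> beta_word \<beta> x) j =
    aligned_word (m + ?k) (\<lambda>i. Digit (beta_digit \<beta> x i)) Star j"
  proof cases
    case 1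
    then have "beta_digit \<beta> x (int (m + ?k) - int j) = 0"
      by (intro beta_digit_above_top[OF assms]) simp
    then show ?thesis using 1 by (simp add: aligned_word_def)
  next
    case 2
    then have len: "j - m < length (rev [0..<Suc ?k])" by simp
    have "rev [0..<Suc ?k] ! (j - m) = m + ?k - j"
      using 2 by (subst rev_nth) (auto simp del: upt_Suc)
    then have "beta_word \<beta> x (j - m) = Digit (beta_digit \<beta> x (int (m + ?k - j)))"
      unfolding beta_word_def using len by (metis (no_types, lifting) conc_fst length_map nth_map)
    moreover have "int (m + ?k - j) = int (m + ?k) - int j" using 2 by simp
    ultimately show ?thesis using 2 by (simp only: aligned_word_def if_True conc_snd length_replicate not_less)
  next
    case 3
    then show ?thesis by (simp add: aligned_word_def beta_word_def)
  next
    case 4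
    then obtain n where "j = Suc (Suc (m + ?k + n))" by (metis add_Suc_right less_iff_Suc_add add_Suc)
    then show ?thesis by (simp add: aligned_word_def beta_word_def algebra_simps)
  qed
qed

lemma top_index_vec_attained: "\<exists>c. top_index \<beta> (x $ c) = top_index_vec \<beta> x"
proof -
  have "top_index_vec \<beta> x \<in> range (\<lambda>c. top_index \<beta> (x $ c))"
    unfolding top_index_vec_def by (rule Max_in) auto
  then show ?thesis by auto
qed

lemma beta_digit_above_top_vec:
  assumes "1 < \<beta>" "int (top_index_vec \<beta> x) < i"
  shows "beta_digit \<beta> (x $ c) i = 0"
  using top_index_le_vec[of \<beta> x c] assms(2) by (intro beta_digit_above_top[OF assms(1)]) simp

lemma beta_digit_top_vec:
  assumes "1 < \<beta>" and "top_index_vec \<beta> x = 0 \<Longrightarrow> \<exists>c. 1 \<le> \<bar>x $ c\<bar>"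
  shows "\<exists>c. beta_digit \<beta> (x $ c) (int (top_index_vec \<beta> x)) \<noteq> 0"
proof (cases "top_index_vec \<beta> x = 0")
  case True
  then obtain c where c: "1 \<le> \<bar>x $ c\<bar>" using assms(2) by blast
  have "top_index \<beta> (x $ c) = 0" using top_index_le_vec[of \<beta> x c] True by simp
  then show ?thesis using beta_digit_top[OF assms(1) c] True by auto
next
  case False
  obtain c where c: "top_index \<beta> (x $ c) = top_index_vec \<beta> x" using top_index_vec_attained by blast
  then have "1 \<le> \<bar>x $ c\<bar>" using False top_index_eq_0_iff[OF assms(1), of "x $ c"] assms(1) by linarith
  then show ?thesis using beta_digit_top[OF assms(1)] c by metis
qed

text \<open>The formula built below identifies the leading position by this property, which speaks only of
  individual digits.\<close>

lemma top_index_vec_iff: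
  assumes "1 < \<beta>"
  shows "k = top_index_vec \<beta> x \<longleftrightarrow>
    (\<forall>i>int k. \<forall>c. beta_digit \<beta> (x $ c) i = 0) \<and> (k = 0 \<or> (\<exists>c. beta_digit \<beta> (x $ c) (int k) \<noteq> 0))"
    (is "_ \<longleftrightarrow> ?top k")
proof
  show "?top k" if "k = top_index_vec \<beta> x"
    using that beta_digit_above_top_vec[OF assms] beta_digit_top_vec[OF assms, of x] by auto
  show "k = top_index_vec \<beta> x" if top: "?top k"
  proof (rule linorder_cases[of k "top_index_vec \<beta> x"])
    assume less: "k < top_index_vec \<beta> x"
    then have "\<exists>c. beta_digit \<beta> (x $ c) (int (top_index_vec \<beta> x)) \<noteq> 0"
      by (intro beta_digit_top_vec[OF assms]) simp
    then show ?thesis using top less by auto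
  next
    assume less: "top_index_vec \<beta> x < k"
    then have "beta_digit \<beta> (x $ c) (int k) = 0" for c by (intro beta_digit_above_top_vec[OF assms]) simp
    then show ?thesis using top less by auto
  qed
qed

text \<open>All letters lie in the alphabet, so the stars of the components are at the same place and
  only the starting position \<open>k\<close> of the word is free. It cannot be smaller than the top index
  of any component, and if it were larger than all of them, the first letter would be zero.\<close>

lemma beta_word_vec_eq:
  fixes x :: "real ^ 'n"
  assumes "1 < \<beta>"
  shows "beta_word_vec \<beta> x = aligned_word (top_index_vec \<beta> x) (digit_vec \<beta> x) star_vec"
    (is "_ = ?w")
proof -
  let ?K = "top_index_vec \<beta> x"
  let ?a = "\<lambda>c i. Digit (beta_digit \<beta> (x $ c) i)"
  have comp: "aligned_word k (digit_vec \<beta> x) star_vec j $ c = aligned_word k (?a c) Star j" for k c j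
    by (simp add: aligned_word_def digit_vec_def star_vec_def)
  have small: "?K = 0" if "\<forall>c. \<bar>x $ c\<bar> < 1"
  proof -
    obtain c where "top_index \<beta> (x $ c) = ?K" using top_index_vec_attained by blast
    moreover have "\<bar>x $ c\<bar> < \<beta>" using that assms by (meson order_less_trans)
    ultimately show ?thesis using top_index_eq_0_iff[OF assms, of "x $ c"] by simp
  qed
  show ?thesis unfolding beta_word_vec_def
  proof (rule the_equality, intro conjI)
    show "\<forall>j. ?w j \<in> alphabet \<beta>"
      using digit_vec_in_alphabet[OF assms, of x] by (simp add: aligned_word_def alphabet_def)
    show "\<forall>c. \<exists>m. (\<lambda>j. ?w j $ c) = replicate m (Digit 0) \<frown> beta_word \<beta> (x $ c)"
    proof
      fix c
      have "?K = (?K - top_index \<beta> (x $ c)) + top_index \<beta> (x $ c)" using top_index_le_vec[of \<beta> x c] by simp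
      then have "(\<lambda>j. ?w j $ c) = replicate (?K - top_index \<beta> (x $ c)) (Digit 0) \<frown> beta_word \<beta> (x $ c)"
        using comp[of ?K] padded_beta_word[OF assms] by presburger
      then show "\<exists>m. (\<lambda>j. ?w j $ c) = replicate m (Digit 0) \<frown> beta_word \<beta> (x $ c)" ..
    qed
    show "if \<forall>c. \<bar>x $ c\<bar> < 1 then ?w 0 = zero_vec \<and> ?w 1 = star_vec else ?w 0 \<noteq> zero_vec"
    proof (cases "\<forall>c. \<bar>x $ c\<bar> < 1")
      case True
      then have "beta_digit \<beta> (x $ c) 0 = 0" for c by (intro beta_digit_eq_0[OF assms]) simp
      then show ?thesis using True small by (simp add: aligned_word_def digit_vec_eq_zero_iff)
    next
      case False
      then have "\<exists>c. beta_digit \<beta> (x $ c) (int ?K) \<noteq> 0"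
        by (intro beta_digit_top_vec[OF assms]) (auto simp: not_less)
      then show ?thesis using False by (auto simp: aligned_word_def digit_vec_eq_zero_iff)
    qed
  next
    fix w :: "(letter ^ 'n) word"
    assume w: "(\<forall>j. w j \<in> alphabet \<beta>) \<and>
      (\<forall>c. \<exists>m. (\<lambda>j. w j $ c) = replicate m (Digit 0) \<frown> beta_word \<beta> (x $ c)) \<and>
      (if \<forall>c. \<bar>x $ c\<bar> < 1 then w 0 = zero_vec \<and> w 1 = star_vec else w 0 \<noteq> zero_vec)"
    then obtain m where m: "\<And>c. (\<lambda>j. w j $ c) = replicate (m c) (Digit 0) \<frown> beta_word \<beta> (x $ c)"
      by metis
    define p where "p c = m c + top_index \<beta> (x $ c)" for c
    have wc: "w j $ c = aligned_word (p c) (?a c) Star j" for j c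
      using fun_cong[OF m[of c], of j] padded_beta_word[OF assms] by (simp add: p_def)
    have p: "p c = p c'" for c c'
    proof -
      have "w (Suc (p c)) $ c = Star" by (simp add: wc aligned_word_star)
      then have "w (Suc (p c)) $ c \<notin> Digit ` signed_digits \<beta>" by auto
      then have "w (Suc (p c)) \<notin> digit_vecs \<beta>" unfolding digit_vecs_def by blast
      then have "w (Suc (p c)) = star_vec" using w by (auto simp: alphabet_def)
      then have "aligned_word (p c') (?a c') Star (Suc (p c)) = Star"
        using wc[of "Suc (p c)" c'] by (simp add: star_vec_def)
      then show ?thesis by (subst (asm) aligned_word_eq_star_iff) auto
    qed
    define k where "k = p undefined"
    have w_eq: "w = aligned_word k (digit_vec \<beta> x) star_vec"
    proof -
      have "p c = k" for c using p by (simp add: k_def)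
      then show ?thesis using wc by (simp add: fun_eq_iff vec_eq_iff comp)
    qed
    have "k = ?K"
    proof (cases "\<forall>c. \<bar>x $ c\<bar> < 1")
      case True
      then have "aligned_word k (digit_vec \<beta> x) star_vec 1 = star_vec" using w w_eq by simp
      then have "1 = Suc k" by (subst (asm) aligned_word_eq_star_iff) (rule digit_vec_neq_star)
      then have "k = 0" by simp
      then show ?thesis using small True by simp
    next
      case False
      obtain c where "top_index \<beta> (x $ c) = ?K" using top_index_vec_attained by blast
      then have "?K \<le> k" using p[of c undefined] by (simp add: k_def p_def)
      moreover have "\<not> ?K < k"
      proof
        assume "?K < k"
        then have "digit_vec \<beta> x (int k) = zero_vec"
          using beta_digit_above_top_vec[OF assms, of x] by (simp add: digit_vec_eq_zero_iff)
        then show False using w False by (simp add: w_eq aligned_word_def)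
      qed
      ultimately show ?thesis by simp
    qed
    then show "w = ?w" by (simp add: w_eq)
  qed
qed

lemma beta_word_vec_inject:
  assumes "1 < \<beta>" "beta_word_vec \<beta> x = beta_word_vec \<beta> y"
  shows "x = y"
proof -
  let ?k = "top_index_vec \<beta> x" and ?l = "top_index_vec \<beta> y"
  have eq: "aligned_word ?k (digit_vec \<beta> x) star_vec = aligned_word ?l (digit_vec \<beta> y) star_vec"
    using assms by (simp add: beta_word_vec_eq)
  then have "aligned_word ?l (digit_vec \<beta> y) star_vec (Suc ?k) = star_vec"
    by (metis aligned_word_star)
  then have "Suc ?k = Suc ?l" by (subst (asm) aligned_word_eq_star_iff) (rule digit_vec_neq_star)
  then have kl: "?k = ?l" by simp
  have "beta_digit \<beta> (x $ c) i = beta_digit \<beta> (y $ c) i" for c i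
  proof (cases "i \<le> int ?k")
    case True
    have "digit_vec \<beta> x i = digit_vec \<beta> y i"
      using eq aligned_word_at[OF True, of "digit_vec \<beta> x" star_vec]
        aligned_word_at[of i ?l "digit_vec \<beta> y" star_vec] True unfolding kl by simp
    then show ?thesis by (simp add: digit_vec_def vec_eq_iff)
  next
    case False
    then show ?thesis
      using beta_digit_above_top_vec[OF assms(1), of x i] beta_digit_above_top_vec[OF assms(1), of y i] kl
      by simp
  qed
  then show ?thesis using beta_digit_inject[OF assms(1)] by (simp add: vec_eq_iff)
qed

section \<open>Runs indexed by digit positions\<close>

text \<open>The state \<open>\<sigma> i\<close> is the one in which the digit at position \<open>i\<close> is read. The star has no position
  of its own, so its transition is merged with the transition at position 0. The state before the
  star is thereby lost, which does not affect whether terminal states recur.\<close>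

lemma buchi_accepts_aligned_word:
  "buchi_accepts M (aligned_word k a s) \<longleftrightarrow>
    (\<exists>\<sigma> :: int \<Rightarrow> nat. \<sigma> (int k) \<in> initial M \<and>
      (\<forall>i\<le>int k. if i = 0
         then \<exists>p. (\<sigma> i, a i, p) \<in> transitions M \<and> (p, s, \<sigma> (i - 1)) \<in> transitions M
         else (\<sigma> i, a i, \<sigma> (i - 1)) \<in> transitions M) \<and>
      (\<forall>m\<le>int k. \<exists>i\<le>m. \<sigma> i \<in> terminal M))"
    (is "_ \<longleftrightarrow> (\<exists>\<sigma>. ?run \<sigma>)")
proof
  assume "buchi_accepts M (aligned_word k a s)"
  then obtain r where r: "r 0 \<in> initial M" "\<And>j. (r j, aligned_word k a s j, r (Suc j)) \<in> transitions M"
    "\<exists>\<^sub>\<infinity>j. r j \<in> terminal M"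
    unfolding buchi_accepts_def by blast
  define pos where "pos i = (if 0 \<le> i then nat (int k - i) else nat (int k + 1 - i))" for i
  have step: "(r (pos i), a i, r (Suc (pos i))) \<in> transitions M" if "i \<le> int k" for i
    using r(2)[of "pos i"] aligned_word_at[OF that, of a s] by (simp add: pos_def)
  have "?run (r \<circ> pos)"
  proof (intro conjI allI impI)
    show "(r \<circ> pos) (int k) \<in> initial M" using r(1) by (simp add: pos_def)
    fix i assume i: "i \<le> int k"
    show "if i = 0
      then \<exists>p. ((r \<circ> pos) i, a i, p) \<in> transitions M \<and> (p, s, (r \<circ> pos) (i - 1)) \<in> transitions M
      else ((r \<circ> pos) i, a i, (r \<circ> pos) (i - 1)) \<in> transitions M"
    proof (cases "i = 0")
      case True
      have "pos i = k" "pos (i - 1) = Suc (Suc k)" using True by (simp_all add: pos_def)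
      then show ?thesis using step[OF i] r(2)[of "Suc k"] True by (auto simp: aligned_word_star)
    next
      case False
      then have "pos (i - 1) = Suc (pos i)" using i by (auto simp: pos_def)
      then show ?thesis using step[OF i] False by simp
    qed
  next
    fix m assume "m \<le> int k"
    obtain j where j: "j \<ge> k + 2 + nat \<bar>m\<bar>" "r j \<in> terminal M" using r(3) by (auto simp: INFM_nat_le)
    then have "int k + 1 - int j \<le> m" "pos (int k + 1 - int j) = j" by (auto simp: pos_def)
    then show "\<exists>i\<le>m. (r \<circ> pos) i \<in> terminal M" using j(2) by (metis comp_apply)
  qed
  then show "\<exists>\<sigma>. ?run \<sigma>" by (rule exI[of ?run "r \<circ> pos"])
next
  assume "\<exists>\<sigma>. ?run \<sigma>"
  then obtain \<sigma> where run: "?run \<sigma>" ..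
  then have \<sigma>: "\<sigma> (int k) \<in> initial M"
    "\<And>i. i \<le> int k \<Longrightarrow> i \<noteq> 0 \<Longrightarrow> (\<sigma> i, a i, \<sigma> (i - 1)) \<in> transitions M"
    "\<And>m. m \<le> int k \<Longrightarrow> \<exists>i\<le>m. \<sigma> i \<in> terminal M"
    by simp_all
  have "0 \<le> int k" by simp
  then obtain p where p: "(\<sigma> 0, a 0, p) \<in> transitions M" "(p, s, \<sigma> (0 - 1)) \<in> transitions M"
    using run by (metis (full_types))
  define r where "r = aligned_word k \<sigma> p"
  have "(r j, aligned_word k a s j, r (Suc j)) \<in> transitions M" for j
  proof -
    consider "j < k" | "j = k" | "j = Suc k" | "Suc k < j" by linarith
    then show ?thesis
    proof cases
      case 1
      then have "int k - int (Suc j) = int k - int j - 1" by simp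
      then show ?thesis using 1 \<sigma>(2)[of "int k - int j"]
        by (simp add: r_def aligned_word_def diff_diff_eq add.commute)
    next
      case 4
      then have "int k + 1 - int (Suc j) = int k + 1 - int j - 1" by simp
      then show ?thesis using 4 \<sigma>(2)[of "int k + 1 - int j"] by (simp add: r_def aligned_word_def)
    qed (use p in \<open>simp_all add: r_def aligned_word_def\<close>)
  qed
  moreover have "r 0 \<in> initial M" using \<sigma>(1) by (simp add: r_def aligned_word_def)
  moreover have "\<exists>\<^sub>\<infinity>j. r j \<in> terminal M"
    unfolding INFM_nat_le
  proof
    fix m :: nat
    obtain i where i: "i \<le> - 1 - int m" "\<sigma> i \<in> terminal M" using \<sigma>(3)[of "- 1 - int m"] by auto
    then have "r (nat (int k + 1 - i)) = \<sigma> i" using aligned_word_at[of i k \<sigma> p] by (simp add: r_def)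
    then show "\<exists>j\<ge>m. r j \<in> terminal M" using i by (intro exI[of _ "nat (int k + 1 - i)"]) auto
  qed
  ultimately show "buchi_accepts M (aligned_word k a s)" unfolding buchi_accepts_def by blast
qed

section \<open>Definable conditions on environments\<close>

text \<open>Free variables are disregarded here, so that no bookkeeping of variables is needed to build
  formulas; \<open>beta_definableI\<close> removes the superfluous ones at the end.\<close>

definition env_definable :: "real \<Rightarrow> (('v \<Rightarrow> real) \<Rightarrow> bool) \<Rightarrow> bool" where
  "env_definable \<beta> P \<longleftrightarrow>
     (\<exists>p. digit_symbols p \<subseteq> signed_digits \<beta> \<and> (\<forall>e. holds \<beta> e p \<longleftrightarrow> P e))"

lemma env_definable_Eq: "env_definable \<beta> (\<lambda>e. tm_val e s = tm_val e t)"
  unfolding env_definable_def by (rule exI[of _ "Eq s t"]) simp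

lemma env_definable_Le: "env_definable \<beta> (\<lambda>e. tm_val e s \<le> tm_val e t)"
  unfolding env_definable_def by (rule exI[of _ "Le s t"]) simp

lemma env_definable_digit:
  "a \<in> signed_digits \<beta> \<Longrightarrow> env_definable \<beta> (\<lambda>e. digit_pred \<beta> a (e u) (e v))"
  unfolding env_definable_def by (rule exI[of _ "DigitAt a (Var u) (Var v)"]) simp

lemma env_definable_not:
  assumes "env_definable \<beta> P"
  shows "env_definable \<beta> (\<lambda>e. \<not> P e)"
proof -
  obtain p where "digit_symbols p \<subseteq> signed_digits \<beta>" "\<forall>e. holds \<beta> e p \<longleftrightarrow> P e"
    using assms unfolding env_definable_def by blast
  then show ?thesis unfolding env_definable_def by (intro exI[of _ "Neg p"]) simp
qed

lemma env_definable_conj: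
  assumes "env_definable \<beta> P" "env_definable \<beta> Q"
  shows "env_definable \<beta> (\<lambda>e. P e \<and> Q e)"
proof -
  obtain p q where "digit_symbols p \<subseteq> signed_digits \<beta>" "\<forall>e. holds \<beta> e p \<longleftrightarrow> P e"
    "digit_symbols q \<subseteq> signed_digits \<beta>" "\<forall>e. holds \<beta> e q \<longleftrightarrow> Q e"
    using assms unfolding env_definable_def by blast
  then show ?thesis unfolding env_definable_def by (intro exI[of _ "Conj p q"]) simp
qed

lemma env_definable_disj:
  assumes "env_definable \<beta> P" "env_definable \<beta> Q"
  shows "env_definable \<beta> (\<lambda>e. P e \<or> Q e)"
  using env_definable_not[OF env_definable_conj[OF env_definable_not[OF assms(1)] env_definable_not[OF assms(2)]]]
  by simp

lemma env_definable_imp: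
  assumes "env_definable \<beta> P" "env_definable \<beta> Q"
  shows "env_definable \<beta> (\<lambda>e. P e \<longrightarrow> Q e)"
  using env_definable_disj[OF env_definable_not[OF assms(1)] assms(2)] by simp

lemma env_definable_const: "env_definable \<beta> (\<lambda>e. c)"
  using env_definable_Eq[of \<beta> One One] env_definable_not[OF env_definable_Eq[of \<beta> One One]]
  by (cases c) simp_all

lemma env_definable_bex:
  assumes "finite A" "\<And>a. a \<in> A \<Longrightarrow> env_definable \<beta> (P a)"
  shows "env_definable \<beta> (\<lambda>e. \<exists>a\<in>A. P a e)"
  using assms by (induction A) (simp_all add: env_definable_const env_definable_disj)

lemma env_definable_ball:
  assumes "finite A" "\<And>a. a \<in> A \<Longrightarrow> env_definable \<beta> (P a)"
  shows "env_definable \<beta> (\<lambda>e. \<forall>a\<in>A. P a e)"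
  using assms by (induction A) (simp_all add: env_definable_const env_definable_conj)

lemma env_definable_ex_upd:
  assumes "env_definable \<beta> P"
  shows "env_definable \<beta> (\<lambda>e. \<exists>r. P (e(v := r)))"
proof -
  obtain p where "digit_symbols p \<subseteq> signed_digits \<beta>" "\<forall>e. holds \<beta> e p \<longleftrightarrow> P e"
    using assms unfolding env_definable_def by blast
  then show ?thesis unfolding env_definable_def by (intro exI[of _ "Ex v p"]) simp
qed

text \<open>The second premise says that \<open>v\<close> does not matter for \<open>R\<close>, hence may serve as the name of the bound
  variable.\<close>

lemma env_definable_ex:
  assumes "env_definable \<beta> (\<lambda>e. R (e v) e)" and "\<And>e r s. R s (e(v := r)) = R s e"
  shows "env_definable \<beta> (\<lambda>e. \<exists>r. R r e)"
  using env_definable_ex_upd[OF assms(1), of v] by (simp add: assms(2))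

lemma env_definable_all:
  assumes "env_definable \<beta> (\<lambda>e. R (e v) e)" and "\<And>e r s. R s (e(v := r)) = R s e"
  shows "env_definable \<beta> (\<lambda>e. \<forall>r. R r e)"
proof -
  have "env_definable \<beta> (\<lambda>e. \<exists>r. \<not> R r e)"
    by (rule env_definable_ex[where v = v]) (simp_all add: assms env_definable_not)
  then show ?thesis using env_definable_not[of \<beta> "\<lambda>e. \<exists>r. \<not> R r e"] by simp
qed

lemma env_definable_ex_override:
  assumes "finite V" "env_definable \<beta> P"
  shows "env_definable \<beta> (\<lambda>e. \<exists>f. P (override_on e f V))"
  using assms
proof (induction V)
  case (insert v V)
  have "(\<exists>f. P (override_on e f (insert v V))) \<longleftrightarrow> (\<exists>r f. P (override_on (e(v := r)) f V))" for e
  proof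
    assume "\<exists>f. P (override_on e f (insert v V))"
    then obtain f where f: "P (override_on e f (insert v V))" ..
    have "override_on e f (insert v V) = override_on (e(v := f v)) f V"
      by (auto simp: override_on_def)
    then show "\<exists>r f. P (override_on (e(v := r)) f V)" using f by metis
  next
    assume "\<exists>r f. P (override_on (e(v := r)) f V)"
    then obtain r f where f: "P (override_on (e(v := r)) f V)" by blast
    have "override_on (e(v := r)) f V = override_on e (f(v := r)) (insert v V)"
      using insert.hyps by (auto simp: override_on_def)
    then show "\<exists>f. P (override_on e f (insert v V))" using f by metis
  qed
  then show ?case
    using env_definable_ex_upd[OF insert.IH[OF insert.prems], of v] by (simp only:)
qed simp

lemma finite_tm_vars: "finite (tm_vars t)"
  by (induction t) simp_all

lemma finite_free_vars: "finite (free_vars p)"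
  by (induction p) (simp_all add: finite_tm_vars)

text \<open>Free variables other than coordinates are bound by existential quantifiers. Since they do not
  influence the truth value, this leaves the meaning of the formula unchanged.\<close>

lemma beta_definableI:
  fixes P :: "('n :: finite + nat \<Rightarrow> real) \<Rightarrow> bool"
  assumes "env_definable \<beta> P" and indep: "\<And>e e'. (\<And>c. e (Inl c) = e' (Inl c)) \<Longrightarrow> P e = P e'"
  shows "beta_definable \<beta> {x. P (case_sum (\<lambda>c. x $ c) (\<lambda>_. 0))}"
proof -
  obtain p where p: "digit_symbols p \<subseteq> signed_digits \<beta>" "\<And>e. holds \<beta> e p = P e"
    using assms(1) unfolding env_definable_def by blast
  obtain vs where vs: "set vs = free_vars p - range Inl"
    using finite_list[of "free_vars p - range Inl"] finite_free_vars by blast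
  have "free_vars (foldr Ex us p) = free_vars p - set us \<and> digit_symbols (foldr Ex us p) = digit_symbols p" for us
    by (induction us) auto
  moreover have "holds \<beta> e (foldr Ex us p) = P e" if "set us \<inter> range Inl = {}" for us e
    using that
  proof (induction us arbitrary: e)
    case (Cons u us)
    have "P (e(u := r)) = P e" for r using Cons.prems by (intro indep) auto
    then show ?case using Cons by simp
  qed (simp add: p)
  moreover have "set vs \<inter> range Inl = {}" using vs by blast
  ultimately show ?thesis using p(1) vs unfolding beta_definable_def
    by (intro exI[of _ "foldr Ex vs p"]) auto
qed

section \<open>Accepting runs coded by real numbers\<close>

definition is_power :: "real \<Rightarrow> real \<Rightarrow> bool" where
  "is_power \<beta> y \<longleftrightarrow> (\<exists>i. y = \<beta> powi i)"

definition next_power :: "real \<Rightarrow> real \<Rightarrow> real \<Rightarrow> bool" where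
  "next_power \<beta> y y' \<longleftrightarrow>
     is_power \<beta> y' \<and> y' < y \<and> (\<forall>u. is_power \<beta> u \<longrightarrow> \<not> (y' < u \<and> u < y))"

text \<open>The reals \<open>z q c\<close> for \<open>c < N\<close> jointly mark the positions with state \<open>q\<close>. That no other state is
  marked is part of the definition: arbitrary reals \<open>z\<close> then determine at most one state for each
  position.\<close>

definition state_at :: "real \<Rightarrow> nat set \<Rightarrow> nat \<Rightarrow> (nat \<Rightarrow> nat \<Rightarrow> real) \<Rightarrow> nat \<Rightarrow> real \<Rightarrow> bool" where
  "state_at \<beta> Q N z q y \<longleftrightarrow>
     q \<in> Q \<and> (\<exists>c\<in>{..<N}. digit_pred \<beta> 1 (z q c) y) \<and>
     (\<forall>q'\<in>Q - {q}. \<forall>c\<in>{..<N}. \<not> digit_pred \<beta> 1 (z q' c) y)"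

definition letter_at :: "real \<Rightarrow> ('n \<Rightarrow> real) \<Rightarrow> letter ^ 'n \<Rightarrow> real \<Rightarrow> bool" where
  "letter_at \<beta> x b y \<longleftrightarrow>
     (\<forall>c\<in>UNIV. \<exists>a\<in>signed_digits \<beta>. b $ c = Digit a \<and> digit_pred \<beta> a (x c) y)"

definition top_power :: "real \<Rightarrow> ('n \<Rightarrow> real) \<Rightarrow> real \<Rightarrow> bool" where
  "top_power \<beta> x y \<longleftrightarrow>
     is_power \<beta> y \<and> 1 \<le> y \<and>
     (\<forall>u. is_power \<beta> u \<and> y < u \<longrightarrow> (\<forall>c\<in>UNIV. digit_pred \<beta> 0 (x c) u)) \<and>
     (y = 1 \<or> (\<exists>c\<in>UNIV. \<not> digit_pred \<beta> 0 (x c) y))"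

text \<open>The transitions that read a letter and then \<open>s\<close>; with \<open>s\<close> the star, these are the steps from
  position 0 to position \<open>-1\<close>.\<close>

definition transitions_via :: "('a \<times> 's \<times> 'a) set \<Rightarrow> 's \<Rightarrow> ('a \<times> 's \<times> 'a) set" where
  "transitions_via E s = {(q, b, q'). \<exists>p. (q, b, p) \<in> E \<and> (p, s, q') \<in> E}"

definition step_at ::
  "real \<Rightarrow> (letter ^ 'n) buchi \<Rightarrow> nat \<Rightarrow> ('n \<Rightarrow> real) \<Rightarrow> (nat \<Rightarrow> nat \<Rightarrow> real) \<Rightarrow> real \<Rightarrow> real \<Rightarrow> bool" where
  "step_at \<beta> M N x z y y' \<longleftrightarrow>
     (y \<noteq> 1 \<and> (\<exists>t\<in>transitions M. state_at \<beta> (states M) N z (fst t) y \<and>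
        letter_at \<beta> x (fst (snd t)) y \<and> state_at \<beta> (states M) N z (snd (snd t)) y')) \<or>
     (y = 1 \<and> (\<exists>t\<in>transitions_via (transitions M) star_vec. state_at \<beta> (states M) N z (fst t) y \<and>
        letter_at \<beta> x (fst (snd t)) y \<and> state_at \<beta> (states M) N z (snd (snd t)) y'))"

text \<open>Positions are represented by the corresponding powers of \<open>\<beta>\<close>, with \<open>y0\<close> the leading one. Every
  quantifier ranges over reals or over a finite set, so that the condition translates into a
  formula.\<close>

definition accepting_run ::
  "real \<Rightarrow> (letter ^ 'n) buchi \<Rightarrow> nat \<Rightarrow> ('n \<Rightarrow> real) \<Rightarrow> real \<Rightarrow> (nat \<Rightarrow> nat \<Rightarrow> real) \<Rightarrow> bool" where
  "accepting_run \<beta> M N x y0 z \<longleftrightarrow>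
     top_power \<beta> x y0 \<and>
     (\<exists>q\<in>initial M. state_at \<beta> (states M) N z q y0) \<and>
     (\<forall>y. is_power \<beta> y \<and> y \<le> y0 \<longrightarrow> (\<exists>y'. next_power \<beta> y y' \<and> step_at \<beta> M N x z y y')) \<and>
     (\<forall>y. is_power \<beta> y \<and> y \<le> y0 \<longrightarrow>
        (\<exists>y'. (is_power \<beta> y' \<and> y' \<le> y) \<and> (\<exists>q\<in>terminal M. state_at \<beta> (states M) N z q y')))"

text \<open>Only finitely many of the reals \<open>z q c\<close> matter, hence finitely many quantifiers suffice.\<close>

lemma accepting_run_cong:
  assumes "\<And>q c. q \<in> states M \<Longrightarrow> c < N \<Longrightarrow> z q c = z' q c"
  shows "accepting_run \<beta> M N x y0 z = accepting_run \<beta> M N x y0 z'"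
proof -
  have "state_at \<beta> (states M) N z = state_at \<beta> (states M) N z'"
    using assms by (auto simp: state_at_def fun_eq_iff)
  then show ?thesis by (simp add: accepting_run_def step_at_def)
qed

context
  fixes \<beta> :: real
  assumes beta_gt_1: "1 < \<beta>"
begin

lemma digit_pred_powi_iff: "digit_pred \<beta> a x (\<beta> powi i) \<longleftrightarrow> beta_digit \<beta> x i = a"
  by (simp add: digit_pred_iff[OF beta_gt_1] powi_eq_iff[OF beta_gt_1])

lemma all_powers_iff: "(\<forall>y. is_power \<beta> y \<and> Q y \<longrightarrow> P y) \<longleftrightarrow> (\<forall>i. Q (\<beta> powi i) \<longrightarrow> P (\<beta> powi i))"
  by (auto simp: is_power_def)

lemma ex_power_iff: "(\<exists>y. (is_power \<beta> y \<and> Q y) \<and> P y) \<longleftrightarrow> (\<exists>i. Q (\<beta> powi i) \<and> P (\<beta> powi i))"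
  by (auto simp: is_power_def)

lemma next_power_powi_iff: "next_power \<beta> (\<beta> powi i) y \<longleftrightarrow> y = \<beta> powi (i - 1)"
proof
  assume next_power: "next_power \<beta> (\<beta> powi i) y"
  then obtain j where j: "y = \<beta> powi j" by (auto simp: next_power_def is_power_def)
  have "j < i" using next_power powi_less_iff[OF beta_gt_1] by (simp add: next_power_def j)
  moreover have "\<not> (j < i - 1 \<and> i - 1 < i)"
    using next_power powi_less_iff[OF beta_gt_1] unfolding next_power_def is_power_def j by blast
  ultimately have "j = i - 1" by simp
  then show "y = \<beta> powi (i - 1)" using j by simp
next
  assume "y = \<beta> powi (i - 1)"
  then show "next_power \<beta> (\<beta> powi i) y"
    by (auto simp: next_power_def is_power_def powi_less_iff[OF beta_gt_1])
qed

lemma letter_at_powi_iff: "letter_at \<beta> (($) x) b (\<beta> powi i) \<longleftrightarrow> b = digit_vec \<beta> x i"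
  using beta_digit_in_signed_digits[OF beta_gt_1]
  by (auto simp: letter_at_def digit_pred_powi_iff digit_vec_def vec_eq_iff)

lemma top_power_iff: "top_power \<beta> (($) x) y \<longleftrightarrow> y = \<beta> powi int (top_index_vec \<beta> x)"
proof -
  have *: "top_power \<beta> (($) x) (\<beta> powi i) \<longleftrightarrow> i = int (top_index_vec \<beta> x)" for i
  proof -
    have "1 \<le> \<beta> powi i \<longleftrightarrow> 0 \<le> i" using powi_le_iff[OF beta_gt_1, of 0 i] by simp
    moreover have "is_power \<beta> (\<beta> powi i)" unfolding is_power_def by blast
    ultimately have top: "top_power \<beta> (($) x) (\<beta> powi i) \<longleftrightarrow> 0 \<le> i \<and>
        (\<forall>l>i. \<forall>c. beta_digit \<beta> (x $ c) l = 0) \<and> (i = 0 \<or> (\<exists>c. beta_digit \<beta> (x $ c) i \<noteq> 0))"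
      unfolding top_power_def all_powers_iff
      by (simp only: digit_pred_powi_iff powi_less_iff[OF beta_gt_1] powi_eq_1_iff[OF beta_gt_1]
          simp_thms ball_UNIV bex_UNIV)
    show ?thesis
    proof (cases "0 \<le> i")
      case True
      then obtain k where "i = int k" using zero_le_imp_eq_int by blast
      then show ?thesis unfolding top using top_index_vec_iff[OF beta_gt_1, of k x] by simp
    qed (unfold top, simp)
  qed
  show ?thesis
  proof
    assume "top_power \<beta> (($) x) y"
    moreover from this obtain i where "y = \<beta> powi i" by (auto simp: top_power_def is_power_def)
    ultimately show "y = \<beta> powi int (top_index_vec \<beta> x)" using * by simp
  next
    assume "y = \<beta> powi int (top_index_vec \<beta> x)"
    then show "top_power \<beta> (($) x) y" using * by blast
  qed
qed

lemma state_at_unique: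
  assumes "state_at \<beta> Q N z q y" "state_at \<beta> Q N z q' y"
  shows "q = q'"
  using assms unfolding state_at_def by blast

text \<open>Positions with the same residue modulo \<open>N\<close> are at least \<open>N\<close> apart, so the positions of each state
  split into \<open>N\<close> sparse sets, which are coded by real numbers.\<close>

lemma exists_encoding:
  assumes "0 < N" "1 / (1 - \<beta> powi (- int N)) < \<beta>" and "\<And>i. i \<le> int k \<Longrightarrow> \<sigma> i \<in> Q"
  shows "\<exists>z. \<forall>i\<le>int k. \<forall>q. state_at \<beta> Q N z q (\<beta> powi i) \<longleftrightarrow> q = \<sigma> i"
proof -
  have "\<exists>w. \<forall>i. beta_digit \<beta> w i = (if i \<in> {i. i \<le> int k \<and> \<sigma> i = q \<and> i mod int N = int c} then 1 else 0)" for q c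
  proof (rule sparse_digits[OF beta_gt_1 assms(1,2)])
    fix i j
    assume "i \<in> {i. i \<le> int k \<and> \<sigma> i = q \<and> i mod int N = int c}"
      "j \<in> {i. i \<le> int k \<and> \<sigma> i = q \<and> i mod int N = int c}" and "i < j"
    then have "int N dvd j - i" by (simp add: mod_eq_dvd_iff[symmetric])
    then have "int N \<le> j - i" using \<open>i < j\<close> by (intro zdvd_imp_le) auto
    then show "i + int N \<le> j" by simp
  qed auto
  then have "\<forall>q c. \<exists>w. \<forall>i. beta_digit \<beta> w i =
      (if i \<in> {i. i \<le> int k \<and> \<sigma> i = q \<and> i mod int N = int c} then 1 else 0)"
    by blast
  then obtain z where z: "\<forall>q c i. beta_digit \<beta> (z q c) i =
      (if i \<in> {i. i \<le> int k \<and> \<sigma> i = q \<and> i mod int N = int c} then 1 else 0)"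
    unfolding choice_iff by blast
  have "state_at \<beta> Q N z q (\<beta> powi i) \<longleftrightarrow> q = \<sigma> i" if i: "i \<le> int k" for i q
  proof -
    have "(\<exists>c\<in>{..<N}. digit_pred \<beta> 1 (z q' c) (\<beta> powi i)) \<longleftrightarrow> q' = \<sigma> i" for q'
    proof -
      have "nat (i mod int N) \<in> {..<N}" "i mod int N = int (nat (i mod int N))"
        using assms(1) by (simp_all add: nat_less_iff)
      then have "\<exists>c\<in>{..<N}. i mod int N = int c" by blast
      then show ?thesis using i by (auto simp: digit_pred_powi_iff z)
    qed
    then show ?thesis using assms(3)[OF i] unfolding state_at_def by blast
  qed
  then show ?thesis by blast
qed

text \<open>A run yields reals by \<open>exists_encoding\<close>. Conversely, the reals determine the state at each
  position uniquely, and the states so obtained form a run.\<close>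

lemma accepting_run_iff:
  fixes x :: "real ^ 'n"
  assumes M: "buchi_automaton A M" and N: "0 < N" "1 / (1 - \<beta> powi (- int N)) < \<beta>"
  shows "buchi_accepts M (beta_word_vec \<beta> x) \<longleftrightarrow> (\<exists>y0 z. accepting_run \<beta> M N (($) x) y0 z)"
proof -
  let ?k = "top_index_vec \<beta> x"
  let ?a = "digit_vec \<beta> x"
  let ?E = "\<lambda>i. if i = 0 then transitions_via (transitions M) star_vec else transitions M"
  let ?st = "\<lambda>z q i. state_at \<beta> (states M) N z q (\<beta> powi i)"
  have trans: "q \<in> states M \<and> q' \<in> states M" if "(q, b, q') \<in> ?E i" for q b q' i
    using that M by (auto simp: transitions_via_def buchi_automaton_def split: if_splits)
  have step: "step_at \<beta> M N (($) x) z (\<beta> powi i) (\<beta> powi (i - 1)) \<longleftrightarrow>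
      (\<exists>q q'. (q, ?a i, q') \<in> ?E i \<and> ?st z q i \<and> ?st z q' (i - 1))" for z i
    by (auto simp: step_at_def powi_eq_1_iff[OF beta_gt_1] letter_at_powi_iff Bex_def)
  have accepts: "buchi_accepts M (beta_word_vec \<beta> x) \<longleftrightarrow>
      (\<exists>\<sigma>. \<sigma> (int ?k) \<in> initial M \<and> (\<forall>i\<le>int ?k. (\<sigma> i, ?a i, \<sigma> (i - 1)) \<in> ?E i) \<and>
        (\<forall>m\<le>int ?k. \<exists>i\<le>m. \<sigma> i \<in> terminal M))"
    unfolding beta_word_vec_eq[OF beta_gt_1] buchi_accepts_aligned_word
    by (intro ex_cong1 conj_cong all_cong1 imp_cong refl) (simp add: transitions_via_def)
  have run: "(\<exists>y0. accepting_run \<beta> M N (($) x) y0 z) \<longleftrightarrow>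
      (\<exists>q\<in>initial M. ?st z q (int ?k)) \<and>
      (\<forall>i\<le>int ?k. \<exists>q q'. (q, ?a i, q') \<in> ?E i \<and> ?st z q i \<and> ?st z q' (i - 1)) \<and>
      (\<forall>m\<le>int ?k. \<exists>i\<le>m. \<exists>q\<in>terminal M. ?st z q i)" for z
    unfolding accepting_run_def top_power_iff all_powers_iff ex_power_iff next_power_powi_iff
    by (simp only: powi_le_iff[OF beta_gt_1] step simp_thms ex_simps)
  show ?thesis
  proof
    assume "buchi_accepts M (beta_word_vec \<beta> x)"
    then obtain \<sigma> where \<sigma>: "\<sigma> (int ?k) \<in> initial M"
      "\<And>i. i \<le> int ?k \<Longrightarrow> (\<sigma> i, ?a i, \<sigma> (i - 1)) \<in> ?E i"
      "\<And>m. m \<le> int ?k \<Longrightarrow> \<exists>i\<le>m. \<sigma> i \<in> terminal M"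
      unfolding accepts by blast
    have "\<sigma> i \<in> states M" if "i \<le> int ?k" for i
      using trans[OF \<sigma>(2)[OF that]] by blast
    then obtain z where z: "\<And>i q. i \<le> int ?k \<Longrightarrow> ?st z q i \<longleftrightarrow> q = \<sigma> i"
      using exists_encoding[OF N, of ?k \<sigma> "states M"] by blast
    have "\<exists>y0. accepting_run \<beta> M N (($) x) y0 z" unfolding run
    proof (intro conjI allI impI)
      show "\<exists>q\<in>initial M. ?st z q (int ?k)" using z[OF order_refl] \<sigma>(1) by blast
      show "\<exists>q q'. (q, ?a i, q') \<in> ?E i \<and> ?st z q i \<and> ?st z q' (i - 1)" if "i \<le> int ?k" for i
        using \<sigma>(2)[OF that] z that by (intro exI conjI) auto
      show "\<exists>i\<le>m. \<exists>q\<in>terminal M. ?st z q i" if m: "m \<le> int ?k" for m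
      proof -
        obtain i where "i \<le> m" "\<sigma> i \<in> terminal M" using \<sigma>(3)[OF m] by blast
        moreover from this have "?st z (\<sigma> i) i" using z m by simp
        ultimately show ?thesis by blast
      qed
    qed
    then show "\<exists>y0 z. accepting_run \<beta> M N (($) x) y0 z" by blast
  next
    assume "\<exists>y0 z. accepting_run \<beta> M N (($) x) y0 z"
    then obtain z where z: "\<exists>y0. accepting_run \<beta> M N (($) x) y0 z" by blast
    from z obtain q0 where q0: "q0 \<in> initial M" "?st z q0 (int ?k)" unfolding run by blast
    from z have steps: "\<And>i. i \<le> int ?k \<Longrightarrow> \<exists>q q'. (q, ?a i, q') \<in> ?E i \<and> ?st z q i \<and> ?st z q' (i - 1)"
      unfolding run by blast
    from z have final: "\<And>m. m \<le> int ?k \<Longrightarrow> \<exists>i\<le>m. \<exists>q\<in>terminal M. ?st z q i"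
      unfolding run by blast
    define \<sigma> where "\<sigma> i = (THE q. ?st z q i)" for i
    have \<sigma>: "\<sigma> i = q" if "?st z q i" for q i
      unfolding \<sigma>_def using that state_at_unique by (intro the_equality) blast+
    show "buchi_accepts M (beta_word_vec \<beta> x)" unfolding accepts
    proof (intro exI[of _ \<sigma>] conjI allI impI)
      show "\<sigma> (int ?k) \<in> initial M"
        using \<sigma> q0 by metis
      show "(\<sigma> i, ?a i, \<sigma> (i - 1)) \<in> ?E i" if i: "i \<le> int ?k" for i
      proof -
        obtain q q' where q: "(q, ?a i, q') \<in> ?E i" "?st z q i" "?st z q' (i - 1)" using steps[OF i] by blast
        then have "\<sigma> i = q" "\<sigma> (i - 1) = q'" using \<sigma> by blast+
        then show ?thesis using q(1) by simp
      qed
      show "\<exists>i\<le>m. \<sigma> i \<in> terminal M" if m: "m \<le> int ?k" for m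
      proof -
        obtain i q where "i \<le> m" "q \<in> terminal M" "?st z q i" using final[OF m] by blast
        then show ?thesis using \<sigma> by metis
      qed
    qed
  qed
qed

lemma one_zero_in_signed_digits: "1 \<in> signed_digits \<beta>" "0 \<in> signed_digits \<beta>"
proof -
  have "1 \<le> \<lceil>\<beta>\<rceil> - 1" using beta_gt_1 by linarith
  then show "1 \<in> signed_digits \<beta>" "0 \<in> signed_digits \<beta>" by (simp_all add: signed_digits_def)
qed

lemma finite_signed_digits: "finite (signed_digits \<beta>)"
  by (simp add: signed_digits_def)

text \<open>Every power of \<open>\<beta>\<close> is a position of every real number, in particular of itself, and the digit
  there is one of finitely many.\<close>

lemma is_power_iff: "is_power \<beta> y \<longleftrightarrow> (\<exists>a\<in>signed_digits \<beta>. digit_pred \<beta> a y y)"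
  using beta_digit_in_signed_digits[OF beta_gt_1]
  by (auto simp: is_power_def digit_pred_iff[OF beta_gt_1])

lemma env_definable_is_power: "env_definable \<beta> (\<lambda>e. is_power \<beta> (e v))"
  unfolding is_power_iff by (intro env_definable_bex env_definable_digit finite_signed_digits)

lemma env_definable_less: "env_definable \<beta> (\<lambda>e. e u < e v)"
  using env_definable_not[OF env_definable_Le[of \<beta> "Var v" "Var u"]] by (simp add: not_le)

lemma env_definable_eq_1: "env_definable \<beta> (\<lambda>e. e v = 1)"
  using env_definable_Eq[of \<beta> "Var v" One] by simp

text \<open>The premises on \<open>w\<close> let it name the bound variable.\<close>

lemma env_definable_next_power:
  assumes "w \<noteq> u" "w \<noteq> v"
  shows "env_definable \<beta> (\<lambda>e. next_power \<beta> (e u) (e v))"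
  unfolding next_power_def
  by (intro env_definable_conj env_definable_is_power env_definable_less
      env_definable_all[where v = w] env_definable_imp env_definable_not)
    (use assms in simp)

lemma env_definable_state_at:
  assumes "finite Q"
  shows "env_definable \<beta> (\<lambda>e. state_at \<beta> Q N (\<lambda>q c. e (f q c)) q (e v))"
  unfolding state_at_def using assms
  by (intro env_definable_conj env_definable_bex env_definable_ball env_definable_not
      env_definable_const env_definable_digit one_zero_in_signed_digits) auto

lemma env_definable_letter_at:
  fixes b :: "letter ^ 'n"
  shows "env_definable \<beta> (\<lambda>e. letter_at \<beta> (\<lambda>c. e (f c)) b (e v))"
  unfolding letter_at_def
  by (intro env_definable_conj env_definable_bex env_definable_ball env_definable_const
      env_definable_digit finite_signed_digits finite)

lemma env_definable_top_power:
  fixes f :: "'n :: finite \<Rightarrow> 'v"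
  assumes "w \<noteq> v" "\<And>c. w \<noteq> f c"
  shows "env_definable \<beta> (\<lambda>e. top_power \<beta> (\<lambda>c. e (f c)) (e v))"
proof -
  have "env_definable \<beta> (\<lambda>e. 1 \<le> e v)" using env_definable_Le[of \<beta> One "Var v"] by simp
  then show ?thesis
    unfolding top_power_def
    by (intro env_definable_conj env_definable_disj env_definable_imp env_definable_not env_definable_bex
        env_definable_ball env_definable_all[where v = w] env_definable_is_power env_definable_less
        env_definable_eq_1 env_definable_digit one_zero_in_signed_digits finite)
      (use assms(1) not_sym[OF assms(2)] in simp_all)
qed

lemma finite_transitions_via:
  assumes "finite E"
  shows "finite (transitions_via E s)"
proof (rule finite_subset)
  show "transitions_via E s \<subseteq> (fst ` E) \<times> (fst \<circ> snd) ` E \<times> (snd \<circ> snd) ` E"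
    by (force simp: transitions_via_def)
qed (use assms in simp)

lemma env_definable_step_at:
  fixes M :: "(letter ^ 'n) buchi"
  assumes "buchi_automaton A M"
  shows "env_definable \<beta> (\<lambda>e. step_at \<beta> M N (\<lambda>c. e (f c)) (\<lambda>q c. e (g q c)) (e u) (e v))"
proof -
  have "finite (states M \<times> A \<times> states M)" using assms by (simp add: buchi_automaton_def)
  then have "finite (transitions M)" by (rule rev_finite_subset) (use assms in \<open>simp add: buchi_automaton_def\<close>)
  moreover have "finite (states M)" using assms by (simp add: buchi_automaton_def)
  ultimately show ?thesis
    unfolding step_at_def
    by (intro env_definable_conj env_definable_disj env_definable_bex env_definable_not env_definable_eq_1
        env_definable_state_at env_definable_letter_at finite_transitions_via)
qed

lemma env_definable_accepting_run:
  fixes M :: "(letter ^ 'n) buchi" and f :: "'n \<Rightarrow> 'v"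
  assumes M: "buchi_automaton A M"
    and fresh: "distinct [u, v, v', w]" "\<And>c. f c \<notin> {v, v', w}" "\<And>q c. g q c \<notin> {v, v'}"
  shows "env_definable \<beta> (\<lambda>e. accepting_run \<beta> M N (\<lambda>c. e (f c)) (e u) (\<lambda>q c. e (g q c)))"
proof -
  have fin: "finite (states M)" "finite (initial M)" "finite (terminal M)"
    using M by (auto simp: buchi_automaton_def intro: finite_subset)
  have le: "env_definable \<beta> (\<lambda>e. e s \<le> e t)" for s t :: 'v
    using env_definable_Le[of \<beta> "Var s" "Var t"] by simp
  show ?thesis
    unfolding accepting_run_def
    by (intro env_definable_conj env_definable_bex env_definable_imp
        env_definable_all[where v = v] env_definable_ex[where v = v'] env_definable_is_power le
        env_definable_top_power[where w = w] env_definable_next_power[where w = w] env_definable_state_at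
        env_definable_step_at[OF M] fin)
      (use fresh in auto)
qed

end

theorem theorem16:
  fixes \<beta> :: real and X :: "(real ^ 'n) set"
  assumes "\<beta> > 1" and "parry_number \<beta>" and "beta_recognizable \<beta> X"
  shows "beta_definable \<beta> X"
proof -
  obtain M where M: "buchi_automaton (alphabet \<beta> :: (letter ^ 'n) set) M"
    and lang: "buchi_language M = beta_word_vec \<beta> ` X"
    using assms(3) unfolding beta_recognizable_def by blast
  obtain N where N: "0 < N" "1 / (1 - \<beta> powi (- int N)) < \<beta>"
    using sparse_gap[OF assms(1)] by blast
  have accepts: "x \<in> X \<longleftrightarrow> buchi_accepts M (beta_word_vec \<beta> x)" for x
  proof -
    have "beta_word_vec \<beta> x \<in> beta_word_vec \<beta> ` X \<longleftrightarrow> x \<in> X"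
      using beta_word_vec_inject[OF assms(1)] by blast
    then show ?thesis using lang by (auto simp: buchi_language_def)
  qed
  (* Inr 0 holds the leading power, Inr 1 to Inr 3 are bound inside the condition, and the
     remaining names hold the reals coding the run. *)
  define v where "v q c = (Inr (4 + prod_encode (q, c)) :: 'n + nat)" for q c
  define R where "R e \<longleftrightarrow>
    accepting_run \<beta> M N (\<lambda>c. e (Inl c)) (e (Inr 0)) (\<lambda>q c. e (v q c))" for e :: "'n + nat \<Rightarrow> real"
  define V where "V = insert (Inr 0) ((\<lambda>(q, c). v q c) ` (states M \<times> {..<N}))"
  have "env_definable \<beta> R"
    unfolding R_def
    by (rule env_definable_accepting_run[OF assms(1) M, where v = "Inr 1" and v' = "Inr 2" and w = "Inr 3"])
      (auto simp: v_def)
  moreover have "finite V" using M by (simp add: buchi_automaton_def V_def)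
  ultimately have guess: "env_definable \<beta> (\<lambda>e. \<exists>f. R (override_on e f V))"
    by (intro env_definable_ex_override)
  define P where "P e \<longleftrightarrow> (\<exists>y0 z. accepting_run \<beta> M N (\<lambda>c. e (Inl c)) y0 z)" for e :: "'n + nat \<Rightarrow> real"
  have R_iff: "R (override_on e f V) \<longleftrightarrow> accepting_run \<beta> M N (\<lambda>c. e (Inl c)) (f (Inr 0)) (\<lambda>q c. f (v q c))" for e f
  proof -
    have "override_on e f V (Inl c) = e (Inl c)" for c by (auto simp: V_def v_def override_on_def)
    moreover have "override_on e f V (Inr 0) = f (Inr 0)" by (simp add: V_def)
    moreover have "override_on e f V (v q c) = f (v q c)" if "q \<in> states M" "c < N" for q c
      using that by (intro override_on_apply_in) (auto simp: V_def)
    then have "accepting_run \<beta> M N x y0 (\<lambda>q c. override_on e f V (v q c)) =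
        accepting_run \<beta> M N x y0 (\<lambda>q c. f (v q c))" for x y0
      by (rule accepting_run_cong)
    ultimately show ?thesis by (simp add: R_def)
  qed
  have P_iff: "P e \<longleftrightarrow> (\<exists>f. R (override_on e f V))" for e
  proof
    assume "P e"
    then obtain y0 z where run: "accepting_run \<beta> M N (\<lambda>c. e (Inl c)) y0 z" unfolding P_def by blast
    define f :: "'n + nat \<Rightarrow> real" where
      "f = case_sum (\<lambda>_. 0) (\<lambda>j. if j = 0 then y0 else case_prod z (prod_decode (j - 4)))"
    have "f (Inr 0) = y0" "(\<lambda>q c. f (v q c)) = z" by (simp_all add: f_def v_def)
    then have "R (override_on e f V)" using run by (simp add: R_iff)
    then show "\<exists>f. R (override_on e f V)" by blast
  next
    assume "\<exists>f. R (override_on e f V)"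
    then show "P e" unfolding P_def R_iff by blast
  qed
  have "env_definable \<beta> P" using guess unfolding P_iff[symmetric] .
  then have "beta_definable \<beta> {x :: real ^ 'n. P (case_sum (\<lambda>c. x $ c) (\<lambda>_. 0))}"
    by (rule beta_definableI) (simp add: P_def)
  moreover have "P (case_sum (\<lambda>c. x $ c) (\<lambda>_. 0)) \<longleftrightarrow> x \<in> X" for x
    using accepting_run_iff[OF assms(1) M N, of x] accepts by (simp add: P_def)
  ultimately show ?thesis by simp
qed

end
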